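(* Let $p$ be an odd prime, $q=p^2$, and let $f\in\mathcal{RF}$ (functions $\mathbb{F}_{p^2}\to\mathbb{F}_p$) with $\varepsilon\in\{\pm1\}$ the sign of its Walsh transform, such that $\varepsilon\eta_0(-1)=-1$. Let $\mathcal{C}_f=\{(af(x)+\mathrm{Tr}_{q/p}(bx)+c)_{x\in\mathbb{F}_q}:a\in\mathbb{F}_p,b\in\mathbb{F}_q,c\in\mathbb{F}_p\}$. Then $\mathcal{C}_f$ is a $(p^2,4,p^2-p-1,p;3)$-LRC and $\mathcal{C}_f^{\perp}$ is a $(p^2,p^2-4,4,p;p^2-p-2)$-LRC. Moreover, $\mathcal{C}_f$ is $k$-optimal, and $\mathcal{C}_f^{\perp}$ is both $k$-optimal and $d$-optimal.
   Context: $\zeta_p=e^{2\pi i/p}$; $\eta_0$ is the quadratic character of $\mathbb{F}_p$; $p^*=(-1)^{(p-1)/2}p$ with $\sqrt{p^*}=\sqrt p$ if $p\equiv1\pmod4$ and $\sqrt{-1}\sqrt p$ otherwise. Weakly regular bent $f:\mathbb{F}_{p^e}\to\mathbb{F}_p$ with sign $\varepsilon$ and dual $f^*$: $\sum_x\zeta_p^{f(x)-\mathrm{Tr}_{p^e/p}(\beta x)}=\varepsilon\sqrt{p^*}^e\zeta_p^{f^*(\beta)}$ for all $\beta$. $\mathcal{RF}$: weakly regular bent $f$ with $f(0)=0$ and $f(ax)=a^hf(x)$ for all $a\in\mathbb{F}_p^*$, $x$, some positive even $h$ with $\gcd(h-1,p-1)=1$. An $(n,k,d,q;r)$-LRC is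 an $[n,k,d]$ linear code over $\mathbb{F}_q$ whose locality is $r$, the locality being the smallest $r$ such that every coordinate $i$ has a set $R_i$ of $r$ other coordinates with $c_i$ a function of $\mathbf{c}_{R_i}$ for all codewords $\mathbf{c}$. $d$-optimal: $d=n-k-\lceil k/r\rceil+2$ (Singleton-like bound met). $k$-optimal: $k=\min_{t\in\mathbb{Z}^+}[rt+k^{(q)}_{opt}(n-t(r+1),d)]$ (Cadambe–Mazumdar bound met), where $k^{(q)}_{opt}(n,d)$ is the largest dimension of a $q$-ary linear code of length $n$ and minimum distance $d$. *)

theory Defs
  imports Complex_Main "HOL-Computational_Algebra.Primes"
begin

text \<open>The field F_{p^e} is modelled by a finite field type 'a with CARD('a) = p^e;
  the prime field F_p is its subfield of elements fixed by x -> x^p.\<close>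

definition Fp :: "nat \<Rightarrow> 'a::{field,finite} set" where
  "Fp p = {x. x ^ p = x}"

definition tr :: "nat \<Rightarrow> nat \<Rightarrow> 'a::{field,finite} \<Rightarrow> 'a" where
  "tr p e x = (\<Sum>i<e. x ^ (p ^ i))"

definition fp_val :: "nat \<Rightarrow> 'a::{field,finite} \<Rightarrow> nat" where
  "fp_val p t = (THE k. k < p \<and> of_nat k = t)"

definition zeta_pow :: "nat \<Rightarrow> 'a::{field,finite} \<Rightarrow> complex" where
  "zeta_pow p t = cis (2 * pi * real (fp_val p t) / real p)"

definition eta0 :: "nat \<Rightarrow> 'a::{field,finite} \<Rightarrow> int" where
  "eta0 p a = (if a = 0 then 0 else if (\<exists>y\<in>Fp p. y ^ 2 = a) then 1 else -1)"

definition sqrt_pstar :: "nat \<Rightarrow> complex" where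
  "sqrt_pstar p = (if p mod 4 = 1 then complex_of_real (sqrt (real p))
                   else \<i> * complex_of_real (sqrt (real p)))"

definition weakly_regular_bent :: "nat \<Rightarrow> nat \<Rightarrow> ('a::{field,finite} \<Rightarrow> 'a) \<Rightarrow> int \<Rightarrow> bool" where
  "weakly_regular_bent p e f \<epsilon> \<longleftrightarrow>
     (\<forall>x. f x \<in> Fp p) \<and> \<epsilon> \<in> {1, -1} \<and>
     (\<exists>fs :: 'a \<Rightarrow> 'a. (\<forall>\<beta>. fs \<beta> \<in> Fp p) \<and>
        (\<forall>\<beta>. (\<Sum>x\<in>UNIV. zeta_pow p (f x - tr p e (\<beta> * x)))
              = of_int \<epsilon> * sqrt_pstar p ^ e * zeta_pow p (fs \<beta>)))"

definition in_RF :: "nat \<Rightarrow> nat \<Rightarrow> ('a::{field,finite} \<Rightarrow> 'a) \<Rightarrow> bool" where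
  "in_RF p e f \<longleftrightarrow>
     (\<exists>\<epsilon>. weakly_regular_bent p e f \<epsilon>) \<and> f 0 = 0 \<and>
     (\<exists>h::nat. h > 0 \<and> even h \<and> gcd (h - 1) (p - 1) = 1 \<and>
        (\<forall>a \<in> Fp p - {0}. \<forall>x. f (a * x) = a ^ h * f x))"

definition vecs :: "'a::field set \<Rightarrow> 'i set \<Rightarrow> ('i \<Rightarrow> 'a) set" where
  "vecs K I = {v. (\<forall>i\<in>I. v i \<in> K) \<and> (\<forall>i. i \<notin> I \<longrightarrow> v i = 0)}"

definition linear_code :: "'a::field set \<Rightarrow> 'i set \<Rightarrow> ('i \<Rightarrow> 'a) set \<Rightarrow> bool" where
  "linear_code K I C \<longleftrightarrow> C \<subseteq> vecs K I \<and> (\<lambda>i. 0) \<in> C \<and>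
     (\<forall>c\<in>C. \<forall>d\<in>C. (\<lambda>i. c i + d i) \<in> C) \<and>
     (\<forall>a\<in>K. \<forall>c\<in>C. (\<lambda>i. a * c i) \<in> C)"

definition code_dim :: "'a::field set \<Rightarrow> ('i \<Rightarrow> 'a) set \<Rightarrow> nat" where
  "code_dim K C = (THE k. card C = card K ^ k)"

definition wt :: "'i set \<Rightarrow> ('i \<Rightarrow> 'a::zero) \<Rightarrow> nat" where
  "wt I c = card {i\<in>I. c i \<noteq> 0}"

definition min_dist :: "'i set \<Rightarrow> ('i \<Rightarrow> 'a::zero) set \<Rightarrow> nat" where
  "min_dist I C = Min {wt I c | c. c \<in> C \<and> c \<noteq> (\<lambda>i. 0)}"

definition dual_code :: "'a::field set \<Rightarrow> 'i set \<Rightarrow> ('i \<Rightarrow> 'a) set \<Rightarrow> ('i \<Rightarrow> 'a) set" where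
  "dual_code K I C = {v \<in> vecs K I. \<forall>c\<in>C. (\<Sum>i\<in>I. c i * v i) = 0}"

definition recovers :: "'i set \<Rightarrow> ('i \<Rightarrow> 'a) set \<Rightarrow> 'i \<Rightarrow> 'i set \<Rightarrow> bool" where
  "recovers I C i R \<longleftrightarrow> R \<subseteq> I - {i} \<and>
     (\<forall>c\<in>C. \<forall>d\<in>C. (\<forall>j\<in>R. c j = d j) \<longrightarrow> c i = d i)"

definition has_locality :: "'i set \<Rightarrow> ('i \<Rightarrow> 'a) set \<Rightarrow> nat \<Rightarrow> bool" where
  "has_locality I C r \<longleftrightarrow> (\<forall>i\<in>I. \<exists>R. card R = r \<and> recovers I C i R)"

definition locality :: "'i set \<Rightarrow> ('i \<Rightarrow> 'a) set \<Rightarrow> nat" where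
  "locality I C = (LEAST r. has_locality I C r)"

definition is_LRC :: "'a::field set \<Rightarrow> 'i set \<Rightarrow> ('i \<Rightarrow> 'a) set \<Rightarrow> nat \<Rightarrow> nat \<Rightarrow> nat \<Rightarrow> nat \<Rightarrow> bool" where
  "is_LRC K I C n k d r \<longleftrightarrow> linear_code K I C \<and> finite I \<and> card I = n \<and>
     code_dim K C = k \<and> min_dist I C = d \<and> locality I C = r"

text \<open>k_opt^{(q)}(n,d): the largest dimension of a linear code over K (q = |K|) of length n
  and minimum distance d (read as: every nonzero codeword has weight at least d).\<close>
definition kopt :: "'a::field set \<Rightarrow> nat \<Rightarrow> nat \<Rightarrow> nat" where
  "kopt K n d = Max {code_dim K C | C :: (nat \<Rightarrow> 'a) set.
       linear_code K {..<n} C \<and> (\<forall>c\<in>C. c \<noteq> (\<lambda>i. 0) \<longrightarrow> wt {..<n} c \<ge> d)}"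

definition d_optimal :: "'a::field set \<Rightarrow> 'i set \<Rightarrow> ('i \<Rightarrow> 'a) set \<Rightarrow> bool" where
  "d_optimal K I C \<longleftrightarrow>
     (let n = card I; k = code_dim K C; d = min_dist I C; r = locality I C in
      int d = int n - int k - \<lceil>real k / real r\<rceil> + 2)"

definition k_optimal :: "'a::field set \<Rightarrow> 'i set \<Rightarrow> ('i \<Rightarrow> 'a) set \<Rightarrow> bool" where
  "k_optimal K I C \<longleftrightarrow>
     (let n = card I; k = code_dim K C; d = min_dist I C; r = locality I C in
      k = (INF t\<in>{1::nat..}. r * t + kopt K (n - t * (r + 1)) d))"

definition code_Cf :: "nat \<Rightarrow> ('a::{field,finite} \<Rightarrow> 'a) \<Rightarrow> ('a \<Rightarrow> 'a) set" where
  "code_Cf p f = {(\<lambda>x. a * f x + tr p 2 (b * x) + c) | a b c. a \<in> Fp p \<and> c \<in> Fp p}"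

end

theory Submission
  imports Defs "HOL-Computational_Algebra.Polynomial" "HOL-Number_Theory.Cong"
begin

text \<open>
  With \<open>\<epsilon> \<eta>\<^sub>0(-1) = -1\<close> every Walsh coefficient of \<open>f\<close> equals \<open>-p \<zeta>^s\<close>. As \<open>1, \<zeta>, \<dots>, \<zeta>^(p-2)\<close> are
  linearly independent over the rationals, every function \<open>f(x) - Tr(bx)\<close> takes one value exactly once
  and all other values exactly \<open>p + 1\<close> times, so a nonzero word of \<open>C\<close> has at most \<open>p + 1\<close> zeros: the
  points \<open>(1, x, f(x))\<close> behave like the affine part of an elliptic quadric. Counting zeros in a pencil
  of words, two independent words have at most two common zeros, hence \<open>C\<close> is onto on any three
  coordinates and \<open>C\<^sup>\<bottom>\<close> has distance at least 4, while any four zeros of a common word carry a dual word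
  of weight 4. Localities are read off the weights of dual words. The bounds on \<open>k\<^sub>o\<^sub>p\<^sub>t\<close> come from
  Plotkin (attained by the repetition code) and Singleton (attained by the dual of \<open>C\<close> restricted to
  the \<open>p + 1\<close> zeros of a word).
\<close>

section \<open>Integral relations between the powers of a primitive root of unity of prime order\<close>

lemma coeff_sum_monom: "coeff (\<Sum>k<n. monom (a k) k) i = (if i < n then a i else 0)"
  by (simp add: coeff_sum)

lemma map_poly_of_int_add:
  "map_poly of_int (P + Q) = map_poly of_int P + (map_poly of_int Q :: 'a::ring_1 poly)"
  by (rule poly_eqI) (simp add: coeff_map_poly)

lemma map_poly_of_int_smult:
  "map_poly of_int (smult a P) = smult (of_int a) (map_poly of_int P :: 'a::comm_ring_1 poly)"
  by (rule poly_eqI) (simp add: coeff_map_poly)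

lemma map_poly_of_int_mult:
  "map_poly of_int (P * Q) = map_poly of_int P * (map_poly of_int Q :: 'a::comm_ring_1 poly)"
  by (rule poly_eqI) (simp add: coeff_map_poly coeff_mult)

lemma poly_of_int_pcompose:
  "poly (map_poly of_int (pcompose P Q)) y
     = poly (map_poly of_int P) (poly (map_poly of_int Q) (y :: 'a::comm_ring_1))"
proof (induction P)
  case (pCons a P)
  then show ?case
    by (simp add: pcompose_pCons map_poly_of_int_add map_poly_of_int_mult map_poly_pCons)
qed simp

lemma poly_of_int_eq_sum:
  assumes "degree P < n"
  shows "poly (map_poly of_int P) (y :: 'a::{comm_ring_1,ring_char_0}) = (\<Sum>j<n. of_int (coeff P j) * y ^ j)"
proof -
  have "degree (map_poly of_int P :: 'a poly) = degree P"
    by (rule degree_map_poly) simp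
  then show ?thesis
    using assms
    by (subst poly_altdef, intro sum.mono_neutral_cong_left)
       (auto simp: coeff_map_poly coeff_eq_0)
qed

section \<open>Eisenstein's criterion and the degree of a root of unity\<close>

text \<open>At the least index \<open>i\<close> where \<open>q\<close> does not divide
  \<open>coeff Q i\<close>, the coefficient of \<open>Q * H\<close> is congruent mod
  \<open>q\<close> to \<open>coeff Q i * coeff H 0\<close>, a non-multiple of the prime
  \<open>q\<close>. So \<open>i\<close> cannot lie below \<open>n\<close>.\<close>

lemma eisenstein_degree:
  fixes Q H :: "int poly"
  assumes "prime q" "\<not> q dvd coeff H 0" "\<not> q dvd lead_coeff Q"
    and "\<And>k. k < n \<Longrightarrow> q dvd coeff (Q * H) k"
  shows "n \<le> degree Q"
proof -
  define i where "i = (LEAST i. \<not> q dvd coeff Q i)"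
  have i: "\<not> q dvd coeff Q i"
    unfolding i_def by (rule LeastI) (fact assms(3))
  have le: "i \<le> degree Q"
    unfolding i_def by (rule Least_le) (fact assms(3))
  have less: "q dvd coeff Q j" if "j < i" for j
    using not_less_Least[of j "\<lambda>i. \<not> q dvd coeff Q i"] that unfolding i_def by blast
  have "\<not> i < n"
  proof
    assume "i < n"
    have "coeff (Q * H) i = (\<Sum>j<i. coeff Q j * coeff H (i - j)) + coeff Q i * coeff H 0"
      by (simp add: coeff_mult flip: lessThan_Suc_atMost)
    moreover have "q dvd (\<Sum>j<i. coeff Q j * coeff H (i - j))"
      using less by (intro dvd_sum) auto
    ultimately have "q dvd coeff Q i * coeff H 0"
      using assms(4)[OF \<open>i < n\<close>] by (simp add: dvd_add_right_iff)
    then show False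
      using assms(1,2) i by (simp add: prime_dvd_mult_iff)
  qed
  with le show ?thesis by simp
qed

text \<open>The polynomial \<open>\<Sum>k<p. (p choose (k+1)) X^k = ((X+1)^p - 1) / X\<close> is Eisenstein at \<open>p\<close>.\<close>

lemma degree_ge_if_root_of_unity_minus_1:
  fixes Q :: "int poly" and y :: complex
  assumes p: "prime p" and y: "(y + 1) ^ p = 1" "y \<noteq> 0"
    and Q: "Q \<noteq> 0" "poly (map_poly of_int Q) y = 0"
  shows "p - 1 \<le> degree Q"
proof -
  define E :: "int poly" where "E = (\<Sum>k<p. monom (int (p choose (Suc k))) k)"
  have coeff_E: "coeff E k = (if k < p then int (p choose (Suc k)) else 0)" for k
    unfolding E_def by (rule coeff_sum_monom)
  have "p > 0" using p by (simp add: prime_gt_0_nat)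
  have E_lead: "coeff E (p - 1) = 1"
    using \<open>p > 0\<close> by (simp add: coeff_E)
  have deg_E: "degree E = p - 1"
  proof (rule antisym)
    show "degree E \<le> p - 1"
      by (rule degree_le) (auto simp: coeff_E)
    show "p - 1 \<le> degree E"
      by (rule le_degree) (use E_lead in simp)
  qed
  have [simp]: "E \<noteq> 0" using E_lead by auto
  have "content E dvd coeff E (p - 1)" by (rule content_dvd_coeff)
  then have cont_E: "content E = 1"
    unfolding E_lead using is_unit_content_iff by blast
  have "y * poly (map_poly of_int E) y = (\<Sum>k<p. of_nat (p choose (Suc k)) * y ^ Suc k)"
  proof -
    have "poly (map_poly of_int E) y = (\<Sum>k<p. of_int (coeff E k) * y ^ k)"
      using \<open>p > 0\<close> deg_E by (intro poly_of_int_eq_sum) simp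
    then show ?thesis
      by (simp add: sum_distrib_left coeff_E mult_ac)
  qed
  also have "\<dots> = (y + 1) ^ p - 1"
    by (subst binomial_ring) (simp add: sum.atMost_shift)
  finally have root_E: "poly (map_poly of_int E) y = 0"
    using y by simp
  define root where "root = (\<lambda>R :: int poly. R \<noteq> 0 \<and> poly (map_poly of_int R) y = 0)"
  \<comment> \<open>An integer polynomial of least degree vanishing at \<open>y\<close> plays the
    role of the minimal polynomial over the rationals; passing to its primitive part prepares
    Gauss's lemma.\<close>
  have "\<exists>M. root M \<and> (\<forall>R. root R \<longrightarrow> degree M \<le> degree R)"
    using ex_has_least_nat[of root Q degree] Q unfolding root_def by blast
  then obtain M0 where M0: "root M0" "\<And>R. root R \<Longrightarrow> degree M0 \<le> degree R" by blast
  define M where "M = primitive_part M0"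
  have "smult (content M0) M = M0" unfolding M_def by simp
  then have "poly (map_poly of_int (smult (content M0) M)) y = 0"
    using M0(1) unfolding root_def by simp
  then have M: "M \<noteq> 0" "content M = 1" "poly (map_poly of_int M) y = 0" "degree M = degree M0"
    using M0(1) unfolding root_def by (auto simp: map_poly_of_int_smult M_def simp del: content_times_primitive_part)
  \<comment> \<open>Division by a non-monic integer polynomial costs the factor \<open>a\<close>.
    The remainder vanishes at \<open>y\<close>, so minimality of the degree makes it zero.\<close>
  obtain a g where a: "a \<noteq> 0" and ag: "smult a E = M * g + pseudo_mod E M"
    and rem: "pseudo_mod E M = 0 \<or> degree (pseudo_mod E M) < degree M"
    using pseudo_mod[OF M(1), of E] by blast
  have "poly (map_poly of_int (smult a E)) y
      = poly (map_poly of_int M) y * poly (map_poly of_int g) y + poly (map_poly of_int (pseudo_mod E M)) y"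
    unfolding ag by (simp add: map_poly_of_int_add map_poly_of_int_mult)
  then have "poly (map_poly of_int (pseudo_mod E M)) y = 0"
    by (simp add: map_poly_of_int_smult root_E M(3))
  then have "pseudo_mod E M = 0"
    using M0(2)[of "pseudo_mod E M"] rem M(4) leD unfolding root_def by metis
  then have ag: "smult a E = M * g" using ag by simp
  \<comment> \<open>Gauss's lemma: \<open>E\<close> and \<open>M\<close> are primitive, so
    \<open>a\<close> divides \<open>g\<close> and cancels. The factor \<open>sgn a\<close> in
    \<open>H\<close> is there because contents are nonnegative.\<close>
  then have "content (smult a E) = content (M * g)" by (rule arg_cong)
  then have "\<bar>a\<bar> = content g"
    by (simp add: content_mult M(2) cont_E)
  define H where "H = smult (sgn a) (primitive_part g)"
  have "g = smult \<bar>a\<bar> (primitive_part g)"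
    unfolding \<open>\<bar>a\<bar> = content g\<close> by (rule content_times_primitive_part[symmetric])
  also have "\<bar>a\<bar> = a * sgn a" by (rule abs_sgn)
  finally have "g = smult a H" unfolding H_def by (metis smult_smult)
  with ag a have EMH: "E = M * H"
    by (metis mult_smult_right smult_cancel)
  have "H \<noteq> 0" using EMH by auto
  have degs: "degree M + degree H = p - 1"
    using degree_mult_eq[OF M(1) \<open>H \<noteq> 0\<close>] EMH deg_E by simp
  have leads: "lead_coeff M * lead_coeff H = 1"
    using lead_coeff_mult[of M H] EMH E_lead deg_E by simp
  have "prime (int p)" using p by simp
  have ndvd: "\<not> int p dvd lead_coeff M" "\<not> int p dvd lead_coeff H"
  proof -
    have "\<not> int p dvd 1" using \<open>prime (int p)\<close> not_prime_unit by blast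
    then show "\<not> int p dvd lead_coeff M" "\<not> int p dvd lead_coeff H"
      using leads by (metis dvd_mult2, metis dvd_mult)
  qed
  have dvdE: "int p dvd coeff E k" if "k < p - 1" for k
  proof -
    have "p dvd (p choose Suc k)"
      using that p by (intro dvd_choose_prime) auto
    then show ?thesis using that by (simp add: coeff_E)
  qed
  \<comment> \<open>The constant term of \<open>E\<close> is \<open>p choose 1\<close>, which
    \<open>p\<close> divides only once, so \<open>p\<close> divides at most one of the two constant
    terms.\<close>
  have "coeff M 0 * coeff H 0 = int p"
  proof -
    have "coeff E 0 = coeff M 0 * coeff H 0" by (simp add: EMH coeff_mult)
    then show ?thesis using \<open>p > 0\<close> by (simp add: coeff_E)
  qed
  have "p - 1 \<le> degree M"
  proof (cases "int p dvd coeff H 0")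
    case False
    then show ?thesis
      using eisenstein_degree[OF \<open>prime (int p)\<close> False ndvd(1)] dvdE EMH by auto
  next
    case True
    have "\<not> int p dvd coeff M 0"
    proof
      assume "int p dvd coeff M 0"
      then have "int p * int p dvd int p"
        using True \<open>coeff M 0 * coeff H 0 = int p\<close> by (metis mult_dvd_mono)
      then have "\<bar>int p\<bar> = 1"
        using \<open>p > 0\<close> zdvd_mult_cancel1[of "int p" "int p"] by simp
      then show False
        using p by auto
    qed
    \<comment> \<open>With the roles of the factors exchanged, \<open>H\<close> takes up the whole
      degree of \<open>E\<close>, and \<open>M\<close> would be a nonzero constant with a
      root.\<close>
    then have "p - 1 \<le> degree H"
      using eisenstein_degree[OF \<open>prime (int p)\<close> _ ndvd(2), of M] dvdE EMH by (auto simp: mult.commute)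
    then have "degree M = 0" using degs by simp
    then obtain c where "M = [:c:]" by (rule degree_eq_zeroE)
    with M(1,3) show ?thesis by (simp add: map_poly_pCons)
  qed
  then show ?thesis
    using M0(2)[of Q] M(4) Q unfolding root_def by simp
qed

text \<open>Subtracting \<open>m (p - 1)\<close> times the vanishing geometric sum leaves an integer
  polynomial \<open>R\<close> of degree below \<open>p - 1\<close> with root \<open>z\<close>. The
  substitution of X + 1 moves the root to \<open>z - 1\<close>, where the degree bound forces
  \<open>R = 0\<close>.\<close>

lemma prime_root_of_unity_relation:
  fixes z :: complex and m :: "nat \<Rightarrow> int"
  assumes p: "prime p" and z: "z ^ p = 1" "z \<noteq> 1"
    and rel: "(\<Sum>j<p. of_int (m j) * z ^ j) = 0" and "i < p"
  shows "m i = m (p - 1)"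
proof -
  have "p > 0" using p by (simp add: prime_gt_0_nat)
  have geo: "(\<Sum>j<p. z ^ j) = 0"
    using z geometric_sum[of z p] by simp
  define R :: "int poly" where "R = (\<Sum>j<p-1. monom (m j - m (p - 1)) j)"
  have coeff_R: "coeff R j = (if j < p - 1 then m j - m (p - 1) else 0)" for j
    unfolding R_def by (rule coeff_sum_monom)
  have "R = 0"
  proof (rule ccontr)
    assume "R \<noteq> 0"
    have "degree R < p - 1"
    proof (rule ccontr)
      assume "\<not> degree R < p - 1"
      then have "lead_coeff R = 0" by (simp add: coeff_R)
      with \<open>R \<noteq> 0\<close> show False by simp
    qed
    have "poly (map_poly of_int R) z = (\<Sum>j<p. of_int (m j - m (p - 1)) * z ^ j)"
    proof -
      have "poly (map_poly of_int R) z = (\<Sum>j<p. of_int (coeff R j) * z ^ j)"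
        using \<open>degree R < p - 1\<close> by (intro poly_of_int_eq_sum) simp
      also have "\<dots> = (\<Sum>j<p. of_int (m j - m (p - 1)) * z ^ j)"
      proof (rule sum.cong)
        fix j assume "j \<in> {..<p}"
        then have "j < p - 1 \<or> j = p - 1" by auto
        then show "of_int (coeff R j) * z ^ j = of_int (m j - m (p - 1)) * z ^ j"
          by (auto simp: coeff_R)
      qed simp
      finally show ?thesis .
    qed
    also have "\<dots> = (\<Sum>j<p. of_int (m j) * z ^ j) - of_int (m (p - 1)) * (\<Sum>j<p. z ^ j)"
      by (simp add: left_diff_distrib sum_subtractf sum_distrib_left)
    finally have "poly (map_poly of_int R) z = 0" by (simp add: rel geo)
    moreover have "pcompose R [:1, 1:] \<noteq> 0"
      using \<open>R \<noteq> 0\<close> by (auto dest: pcompose_eq_0)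
    moreover have "degree (pcompose R [:1, 1:]) = degree R" by (simp add: degree_pcompose)
    ultimately show False
      using degree_ge_if_root_of_unity_minus_1[OF p, of "z - 1" "pcompose R [:1, 1:]"] z
        \<open>degree R < p - 1\<close>
      by (simp add: poly_of_int_pcompose map_poly_pCons)
  qed
  then have "coeff R i = 0" by simp
  then show ?thesis
    using coeff_R[of i] \<open>i < p\<close> by (cases "i = p - 1") (auto split: if_splits)
qed

section \<open>Linear codes over a prime field\<close>

locale prime_subfield =
  fixes p :: nat and K :: "'a::{field,finite} set"
  assumes prime_p: "prime p" and char_p: "CHAR('a) = p" and K_def: "K = Fp p"
begin

section \<open>Arithmetic of the prime subfield\<close>

lemma p_gt_0: "p > 0" and p_gt_1: "p > 1"
  using prime_gt_0_nat[OF prime_p] prime_gt_1_nat[OF prime_p] by auto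

lemma of_nat_eq_iff_mod: "(of_nat i :: 'a) = of_nat j \<longleftrightarrow> i mod p = j mod p"
  using of_nat_eq_iff_cong_CHAR[where 'a='a] by (simp add: char_p cong_def)

lemma inj_of_nat: "inj_on (of_nat :: nat \<Rightarrow> 'a) {..<p}"
  by (auto simp: inj_on_def of_nat_eq_iff_mod)

lemma of_nat_in_K [simp]: "of_nat i \<in> K"
proof -
  have "(of_nat i :: 'a) ^ p = of_nat i"
  proof (induction i)
    case 0
    then show ?case using p_gt_0 by simp
  next
    case (Suc i)
    have "(1 + of_nat i :: 'a) ^ p = 1 ^ p + of_nat i ^ p"
      by (rule freshmans_dream) (simp_all add: char_p prime_p)
    then show ?case using Suc by simp
  qed
  then show ?thesis by (simp add: K_def Fp_def)
qed

lemma card_roots_le: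
  fixes P :: "'a poly"
  assumes "P \<noteq> 0" "\<And>x. x \<in> A \<Longrightarrow> poly P x = 0"
  shows "card A \<le> degree P"
proof -
  have "card A \<le> card {x. poly P x = 0}"
    by (rule card_mono) (use assms(2) in auto)
  also have "\<dots> \<le> degree P" by (rule card_poly_roots_bound) (fact assms(1))
  finally show ?thesis .
qed

text \<open>The first \<open>p\<close> multiples of 1 are distinct in characteristic
  \<open>p\<close>, and they exhaust \<open>K\<close> because X^p - X has at most \<open>p\<close>
  roots.\<close>

lemma K_eq_of_nat: "K = of_nat ` {..<p}"
proof (rule sym, rule card_subset_eq)
  show "finite K" by simp
  show "of_nat ` {..<p} \<subseteq> K" by auto
  let ?P = "monom 1 p - monom 1 1 :: 'a poly"
  have "coeff ?P p = 1" using p_gt_1 by simp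
  then have "?P \<noteq> 0" by (metis coeff_0 zero_neq_one)
  have "degree ?P \<le> p"
    using p_gt_1 by (intro degree_diff_le) (auto simp: degree_monom_eq)
  have "card K \<le> degree ?P"
    by (rule card_roots_le[OF \<open>?P \<noteq> 0\<close>]) (auto simp: K_def Fp_def poly_monom)
  then have "card K \<le> p" using \<open>degree ?P \<le> p\<close> by simp
  moreover have "card (of_nat ` {..<p} :: 'a set) = p"
    using card_image[OF inj_of_nat] by simp
  moreover have "card (of_nat ` {..<p} :: 'a set) \<le> card K"
    by (rule card_mono) auto
  ultimately show "card (of_nat ` {..<p} :: 'a set) = card K" by simp
qed

lemma card_K: "card K = p"
  unfolding K_eq_of_nat using card_image[OF inj_of_nat] by simp

lemma K_cases:
  assumes "x \<in> K" obtains i where "i < p" "x = of_nat i"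
  using assms unfolding K_eq_of_nat by auto

lemma K_0 [simp]: "0 \<in> K" and K_1 [simp]: "1 \<in> K"
  using of_nat_in_K[of 0] of_nat_in_K[of 1] by simp_all

lemma K_add [intro]: "x \<in> K \<Longrightarrow> y \<in> K \<Longrightarrow> x + y \<in> K"
  by (elim K_cases) (simp flip: of_nat_add)

lemma K_mult [intro]: "x \<in> K \<Longrightarrow> y \<in> K \<Longrightarrow> x * y \<in> K"
  by (elim K_cases) (simp flip: of_nat_mult)

lemma K_inverse [intro]: "x \<in> K \<Longrightarrow> inverse x \<in> K"
  by (simp add: K_def Fp_def power_inverse)

lemma K_uminus [intro]: "x \<in> K \<Longrightarrow> - x \<in> K"
proof -
  assume x: "x \<in> K"
  \<comment> \<open>In characteristic \<open>p\<close> the scalar -1 is the natural number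
    \<open>p - 1\<close>, so negation is a multiplication inside \<open>K\<close>.\<close>
  have "(of_nat (p - 1) :: 'a) = of_nat p - 1" using p_gt_0 by (simp add: of_nat_diff)
  also have "(of_nat p :: 'a) = 0" using of_nat_CHAR[where 'a='a] by (simp add: char_p)
  finally show "- x \<in> K" using K_mult[OF of_nat_in_K[of "p - 1"] x] by simp
qed

lemma K_diff [intro]: "x \<in> K \<Longrightarrow> y \<in> K \<Longrightarrow> x - y \<in> K"
  using K_add[of x "- y"] by auto

lemma K_divide [intro]: "x \<in> K \<Longrightarrow> y \<in> K \<Longrightarrow> x / y \<in> K"
  by (simp add: divide_inverse K_mult K_inverse)

lemma K_sum [intro]: "(\<And>i. i \<in> A \<Longrightarrow> g i \<in> K) \<Longrightarrow> sum g A \<in> K"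
  by (induction A rule: infinite_finite_induct) auto

section \<open>The additive character of the prime field\<close>

lemma cis_power_p: "cis (2 * pi / real p) ^ p = 1"
  using p_gt_0 by (simp add: DeMoivre)

text \<open>Periodicity allows any natural number as representative, not only the reduced one, so
  additivity of the character becomes the law of exponents.\<close>

lemma zeta_pow_of_nat: "zeta_pow p (of_nat i :: 'a) = cis (2 * pi / real p) ^ i"
proof -
  have fp: "fp_val p (of_nat i :: 'a) = i mod p"
    unfolding fp_val_def
    by (rule the_equality) (use p_gt_0 in \<open>auto simp: of_nat_eq_iff_mod\<close>)
  have "cis (2 * pi / real p) ^ i = cis (2 * pi / real p) ^ (p * (i div p) + i mod p)" by simp
  also have "\<dots> = cis (2 * pi / real p) ^ (i mod p)"
    unfolding power_add power_mult cis_power_p by simp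
  also have "\<dots> = zeta_pow p (of_nat i :: 'a)"
    unfolding zeta_pow_def fp by (simp add: DeMoivre mult_ac)
  finally show ?thesis by simp
qed

lemma zeta_pow_0 [simp]: "zeta_pow p (0 :: 'a) = 1"
  using zeta_pow_of_nat[of 0] by simp

lemma zeta_pow_add: "x \<in> K \<Longrightarrow> y \<in> K \<Longrightarrow> zeta_pow p (x + y) = zeta_pow p x * zeta_pow p y"
  by (elim K_cases) (simp add: zeta_pow_of_nat power_add flip: of_nat_add)

lemma cis_neq_1: "cis (2 * pi / real p) \<noteq> 1"
proof
  assume "cis (2 * pi / real p) = 1"
  then have "cos (2 * pi / real p) = 1" by (metis cis.sel(1) one_complex.sel(1))
  then obtain k :: int where k: "2 * pi / real p = of_int k * 2 * pi"
    using cos_one_2pi_int by auto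
  then have "real_of_int k * real p = 1" using p_gt_0 by (simp add: field_simps)
  then have "k * int p = 1" by (metis of_int_eq_1_iff of_int_mult of_int_of_nat_eq)
  then show False using p_gt_1 by (simp add: zmult_eq_1_iff)
qed

lemma zeta_pow_1_neq_1: "zeta_pow p (1 :: 'a) \<noteq> 1"
  using zeta_pow_of_nat[of 1] cis_neq_1 by simp

section \<open>Codes, the pairing and duality\<close>

definition inner :: "'i set \<Rightarrow> ('i \<Rightarrow> 'a) \<Rightarrow> ('i \<Rightarrow> 'a) \<Rightarrow> 'a" where
  "inner I c v = (\<Sum>i\<in>I. c i * v i)"

lemma linear_codeD:
  assumes "linear_code K I C"
  shows "C \<subseteq> vecs K I" "(\<lambda>i. 0) \<in> C"
    "\<And>c d. c \<in> C \<Longrightarrow> d \<in> C \<Longrightarrow> (\<lambda>i. c i + d i) \<in> C"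
    "\<And>a c. a \<in> K \<Longrightarrow> c \<in> C \<Longrightarrow> (\<lambda>i. a * c i) \<in> C"
    "\<And>c d. c \<in> C \<Longrightarrow> d \<in> C \<Longrightarrow> (\<lambda>i. c i - d i) \<in> C"
proof -
  show a: "C \<subseteq> vecs K I" "(\<lambda>i. 0) \<in> C"
    "\<And>c d. c \<in> C \<Longrightarrow> d \<in> C \<Longrightarrow> (\<lambda>i. c i + d i) \<in> C"
    "\<And>a c. a \<in> K \<Longrightarrow> c \<in> C \<Longrightarrow> (\<lambda>i. a * c i) \<in> C"
    using assms unfolding linear_code_def by auto
  fix c d assume "c \<in> C" "d \<in> C"
  with a(3)[OF _ a(4)[of "-1" d], of c] show "(\<lambda>i. c i - d i) \<in> C" by (auto simp: K_uminus)
qed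

lemma vecs_altdef: "vecs K I = {v. (\<forall>i. v i \<in> K) \<and> (\<forall>i. i \<notin> I \<longrightarrow> v i = 0)}"
proof -
  have "v i \<in> K" if "\<forall>i\<in>I. v i \<in> K" "\<forall>i. i \<notin> I \<longrightarrow> v i = 0" for v :: "'b \<Rightarrow> 'a" and i
    using that by (cases "i \<in> I") auto
  then show ?thesis unfolding vecs_def by blast
qed

lemma vecs_in_K: "v \<in> vecs K I \<Longrightarrow> v i \<in> K"
  by (simp add: vecs_altdef)

lemma vecs_mono: "S \<subseteq> I \<Longrightarrow> vecs K S \<subseteq> vecs K I"
  unfolding vecs_altdef by auto

lemma linear_code_vecs: "linear_code K I (vecs K I)"
  unfolding linear_code_def by (auto simp: vecs_altdef)

lemma card_vecs:
  assumes "finite I"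
  shows "finite (vecs K I)" "card (vecs K I) = p ^ card I"
proof -
  have "finite (vecs K I) \<and> card (vecs K I) = p ^ card I"
    using assms
  proof (induction I)
    case empty
    have "vecs K {} = {\<lambda>i. 0}" by (auto simp: vecs_altdef)
    then show ?case by (metis card.empty finite.emptyI finite.insertI is_singletonI is_singleton_altdef power_0)
  next
    case (insert j I)
    have "bij_betw (\<lambda>(a, v). v(j := a)) (K \<times> vecs K I) (vecs K (insert j I))"
      by (rule bij_betw_byWitness[where f' = "\<lambda>v. (v j, v(j := 0))"])
         (use insert.hyps in \<open>auto simp: vecs_altdef fun_eq_iff\<close>)
    then have "card (vecs K (insert j I)) = card (K \<times> vecs K I)"
      "finite (vecs K (insert j I)) = finite (K \<times> vecs K I)"
      using bij_betw_same_card bij_betw_finite by metis+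
    then show ?case using insert by (simp add: card_cartesian_product card_K)
  qed
  then show "finite (vecs K I)" "card (vecs K I) = p ^ card I" by auto
qed

lemma linear_code_finite: "finite I \<Longrightarrow> linear_code K I C \<Longrightarrow> finite C"
  using card_vecs(1) linear_codeD(1) finite_subset by metis

lemma linear_code_card_pos: "finite I \<Longrightarrow> linear_code K I C \<Longrightarrow> card C > 0"
  using linear_code_finite linear_codeD(2) card_gt_0_iff by blast

lemma inner_in_K: "c \<in> vecs K I \<Longrightarrow> v \<in> vecs K I \<Longrightarrow> inner I c v \<in> K"
  unfolding inner_def by (intro K_sum K_mult) (auto simp: vecs_altdef)

lemma inner_add_left: "inner I (\<lambda>i. c i + d i) v = inner I c v + inner I d v"
  by (simp add: inner_def algebra_simps sum.distrib)

lemma inner_scale_left: "inner I (\<lambda>i. a * c i) v = a * inner I c v"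
  by (simp add: inner_def algebra_simps sum_distrib_left)

lemma inner_add_right: "inner I v (\<lambda>i. c i + d i) = inner I v c + inner I v d"
  by (simp add: inner_def algebra_simps sum.distrib)

lemma inner_scale_right: "inner I v (\<lambda>i. a * c i) = a * inner I v c"
  by (simp add: inner_def algebra_simps sum_distrib_left)

lemma inner_commute: "inner I c v = inner I v c"
  by (simp add: inner_def mult.commute)

lemma dual_code_altdef: "dual_code K I C = {v \<in> vecs K I. \<forall>c\<in>C. inner I c v = 0}"
  by (simp add: dual_code_def inner_def)

lemma linear_code_dual: "linear_code K I (dual_code K I C)"
  unfolding linear_code_def dual_code_altdef
  by (auto simp: vecs_altdef inner_add_right inner_scale_right) (simp add: inner_def)

text \<open>Orthogonality of characters: outside the dual some codeword can be scaled to a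
  \<open>c1\<close> pairing to 1 with \<open>v\<close>. Translation by \<open>c1\<close> permutes
  \<open>C\<close> and multiplies the sum by \<open>zeta_pow p 1\<close>, which is not 1.\<close>

lemma code_character_sum:
  assumes "finite I" and C: "linear_code K I C" and v: "v \<in> vecs K I"
  shows "(\<Sum>c\<in>C. zeta_pow p (inner I c v)) = (if v \<in> dual_code K I C then of_nat (card C) else 0)"
proof (cases "v \<in> dual_code K I C")
  case True
  then show ?thesis by (simp add: dual_code_altdef)
next
  case False
  then obtain c0 where c0: "c0 \<in> C" "inner I c0 v \<noteq> 0"
    using v by (auto simp: dual_code_altdef)
  have K: "inner I c v \<in> K" if "c \<in> C" for c
    using that linear_codeD(1)[OF C] v by (intro inner_in_K) auto
  define c1 where "c1 = (\<lambda>i. inverse (inner I c0 v) * c0 i)"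
  have c1: "c1 \<in> C" "inner I c1 v = 1"
    using c0 linear_codeD(4)[OF C K_inverse[OF K] c0(1)] by (auto simp: c1_def inner_scale_left)
  have "(\<Sum>c\<in>C. zeta_pow p (inner I c v)) = (\<Sum>c\<in>C. zeta_pow p (inner I (\<lambda>i. c i + c1 i) v))"
    by (rule sum.reindex_bij_witness[of _ "\<lambda>c i. c i + c1 i" "\<lambda>c i. c i - c1 i"])
       (use c1 linear_codeD(3,5)[OF C] in auto)
  also have "\<dots> = (\<Sum>c\<in>C. zeta_pow p (inner I c v)) * zeta_pow p (1 :: 'a)"
    using K c1 by (simp add: inner_add_left zeta_pow_add sum_distrib_right)
  finally have "(\<Sum>c\<in>C. zeta_pow p (inner I c v)) * (1 - zeta_pow p (1 :: 'a)) = 0"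
    by (simp add: algebra_simps)
  then show ?thesis using zeta_pow_1_neq_1 False by simp
qed

lemma dual_vecs:
  assumes "finite I" shows "dual_code K I (vecs K I) = {\<lambda>i. 0}"
proof -
  have "v = (\<lambda>i. 0)" if v: "v \<in> vecs K I" and orth: "\<And>c. c \<in> vecs K I \<Longrightarrow> inner I c v = 0" for v
  proof
    fix i
    show "v i = 0"
    proof (cases "i \<in> I")
      case True
      then have "(\<lambda>j. if j = i then 1 else 0) \<in> vecs K I" by (auto simp: vecs_altdef)
      then have "inner I (\<lambda>j. if j = i then 1 else 0) v = 0" by (rule orth)
      then show ?thesis using True assms by (simp add: inner_def if_distrib[of "\<lambda>x. x * _"] cong: if_cong)
    qed (use v in \<open>auto simp: vecs_altdef\<close>)
  qed
  moreover have "inner I c (\<lambda>i. 0) = 0" for c by (simp add: inner_def)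
  ultimately show ?thesis by (auto simp: dual_code_altdef vecs_altdef)
qed

text \<open>Evaluate the double character sum over \<open>C \<times> K\<^sup>I\<close> in both orders.\<close>

theorem card_mult_card_dual:
  assumes "finite I" and C: "linear_code K I C"
  shows "card C * card (dual_code K I C) = p ^ card I"
proof -
  let ?V = "vecs K I"
  have "(\<Sum>v\<in>?V. \<Sum>c\<in>C. zeta_pow p (inner I c v)) = (\<Sum>v\<in>?V. if v \<in> dual_code K I C then of_nat (card C) else 0)"
    by (rule sum.cong) (auto simp: code_character_sum[OF assms])
  also have "\<dots> = (\<Sum>v\<in>dual_code K I C. of_nat (card C))"
    using card_vecs(1)[OF assms(1)]
    by (intro sum.mono_neutral_cong_right) (auto simp: dual_code_altdef)
  finally have 1: "(\<Sum>v\<in>?V. \<Sum>c\<in>C. zeta_pow p (inner I c v)) = of_nat (card C * card (dual_code K I C))"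
    by (simp add: mult.commute)
  \<comment> \<open>With the full space summed first, only the zero codeword contributes, being the
    only vector orthogonal to everything.\<close>
  have "(\<Sum>c\<in>C. \<Sum>v\<in>?V. zeta_pow p (inner I v c)) = (\<Sum>c\<in>C. if c = (\<lambda>i. 0) then of_nat (card ?V) else 0)"
    using linear_codeD(1)[OF C]
    by (intro sum.cong)
       (auto simp: code_character_sum[OF assms(1) linear_code_vecs] dual_vecs[OF assms(1)])
  also have "\<dots> = of_nat (card ?V)"
    using linear_code_finite[OF assms] linear_codeD(2)[OF C] by simp
  finally have 2: "(\<Sum>c\<in>C. \<Sum>v\<in>?V. zeta_pow p (inner I v c)) = of_nat (card ?V)" .
  have "(\<Sum>v\<in>?V. \<Sum>c\<in>C. zeta_pow p (inner I c v)) = (\<Sum>c\<in>C. \<Sum>v\<in>?V. zeta_pow p (inner I v c))"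
    by (subst sum.swap) (simp add: inner_commute)
  then have "(of_nat (card C * card (dual_code K I C)) :: complex) = of_nat (card ?V)"
    using 1 2 by simp
  then show ?thesis
    using card_vecs(2)[OF assms(1)] by (metis of_nat_eq_iff)
qed

text \<open>One inclusion is formal; equality follows by counting, as the product formula applied to
  \<open>C\<close> and to its dual gives both sides the same cardinality.\<close>

lemma bidual:
  assumes "finite I" and C: "linear_code K I C"
  shows "dual_code K I (dual_code K I C) = C"
proof (rule sym, rule card_subset_eq)
  note D = linear_code_dual[of I C]
  show "finite (dual_code K I (dual_code K I C))"
    by (rule linear_code_finite[OF assms(1) linear_code_dual])
  show "C \<subseteq> dual_code K I (dual_code K I C)"
    using linear_codeD(1)[OF C] by (auto simp: dual_code_altdef inner_commute)
  have "card C * card (dual_code K I C) = card (dual_code K I (dual_code K I C)) * card (dual_code K I C)"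
    using card_mult_card_dual[OF assms] card_mult_card_dual[OF assms(1) D] by (simp add: mult.commute)
  then show "card C = card (dual_code K I (dual_code K I C))"
    using linear_code_card_pos[OF assms(1) D] by simp
qed

text \<open>Replaces the choice of a basis: the cardinality divides a power of the prime
  \<open>p\<close>.\<close>

lemma card_code_eq_power:
  assumes "finite I" "linear_code K I C"
  obtains k where "k \<le> card I" "card C = p ^ k"
proof -
  have "card C dvd p ^ card I" using card_mult_card_dual[OF assms] by (metis dvd_triv_left)
  then show ?thesis using that divides_primepow_nat[OF prime_p] by auto
qed

lemma code_dim_eqI: "card C = p ^ k \<Longrightarrow> code_dim K C = k"
  unfolding code_dim_def card_K by (rule the_equality) (use p_gt_1 in auto)

lemma card_eq_power_code_dim:
  assumes "finite I" "linear_code K I C"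
  shows "card C = p ^ code_dim K C" "code_dim K C \<le> card I"
  using card_code_eq_power[OF assms] code_dim_eqI by metis+

section \<open>Restriction to a set of coordinates\<close>

text \<open>Positions outside \<open>S\<close> are zeroed rather than dropped, since
  \<open>vecs\<close> represents a word by its extension by zero.\<close>

definition restr :: "'i set \<Rightarrow> ('i \<Rightarrow> 'a) \<Rightarrow> 'i \<Rightarrow> 'a" where
  "restr S c = (\<lambda>i. if i \<in> S then c i else 0)"

lemma linear_code_restr:
  assumes C: "linear_code K I C" and "S \<subseteq> I"
  shows "linear_code K S (restr S ` C)"
  unfolding linear_code_def
proof (intro conjI ballI)
  show "restr S ` C \<subseteq> vecs K S"
    using linear_codeD(1)[OF C] \<open>S \<subseteq> I\<close> by (auto simp: restr_def vecs_altdef)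
  show "(\<lambda>i. 0) \<in> restr S ` C"
    using linear_codeD(2)[OF C] by (auto simp: restr_def image_def intro!: bexI[of _ "\<lambda>i. 0"])
next
  fix c d assume "c \<in> restr S ` C" "d \<in> restr S ` C"
  then obtain c' d' where "c' \<in> C" "d' \<in> C" "c = restr S c'" "d = restr S d'" by auto
  then have "(\<lambda>i. c i + d i) = restr S (\<lambda>i. c' i + d' i)" by (auto simp: restr_def)
  then show "(\<lambda>i. c i + d i) \<in> restr S ` C"
    using linear_codeD(3)[OF C \<open>c' \<in> C\<close> \<open>d' \<in> C\<close>] by simp
next
  fix a c assume "a \<in> K" "c \<in> restr S ` C"
  then obtain c' where "c' \<in> C" "c = restr S c'" by auto
  then have "(\<lambda>i. a * c i) = restr S (\<lambda>i. a * c' i)" by (auto simp: restr_def)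
  then show "(\<lambda>i. a * c i) \<in> restr S ` C"
    using linear_codeD(4)[OF C \<open>a \<in> K\<close> \<open>c' \<in> C\<close>] by simp
qed

text \<open>Puncturing and shortening are dual: the pairing with a word supported on
  \<open>S\<close> sees a codeword only through its restriction to \<open>S\<close>.\<close>

lemma dual_restr_iff:
  assumes "finite I" "S \<subseteq> I"
  shows "w \<in> dual_code K S (restr S ` C) \<longleftrightarrow> w \<in> vecs K S \<and> w \<in> dual_code K I C"
proof (cases "w \<in> vecs K S")
  case True
  have "inner I c w = inner S (restr S c) w" for c
    unfolding inner_def using assms(1,2) True
    by (intro sum.mono_neutral_cong_right) (auto simp: restr_def vecs_altdef)
  then show ?thesis
    using True vecs_mono[OF assms(2)] by (auto simp: dual_code_altdef)
qed (simp add: dual_code_altdef)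

text \<open>Rank-nullity in counting form: each fibre of the restriction is a translate of the
  subcode vanishing on \<open>S\<close>.\<close>

lemma card_restr:
  assumes "finite I" and C: "linear_code K I C"
  shows "card (restr S ` C) * card {c \<in> C. \<forall>i\<in>S. c i = 0} = card C"
proof -
  note fin = linear_code_finite[OF assms]
  have fibre: "card {c \<in> C. restr S c = d} = card {c \<in> C. \<forall>i\<in>S. c i = 0}" if "d \<in> restr S ` C" for d
  proof -
    from that obtain c0 where c0: "c0 \<in> C" "d = restr S c0" by auto
    have eq: "restr S c = restr S c0 \<longleftrightarrow> (\<forall>i\<in>S. c i = c0 i)" for c
      by (auto simp: restr_def fun_eq_iff)
    show ?thesis
      by (rule bij_betw_same_card[of "\<lambda>c i. c i - c0 i"],
          rule bij_betw_byWitness[where f' = "\<lambda>c i. c i + c0 i"])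
         (use c0 linear_codeD(3,5)[OF C] in \<open>auto simp: eq\<close>)
  qed
  have "card C = (\<Sum>c\<in>C. 1)" by simp
  also have "\<dots> = (\<Sum>d\<in>restr S ` C. \<Sum>c\<in>{c \<in> C. restr S c = d}. 1)"
    by (rule sum.image_gen[OF fin])
  also have "\<dots> = (\<Sum>d\<in>restr S ` C. card {c \<in> C. \<forall>i\<in>S. c i = 0})"
    by (rule sum.cong) (auto simp: fibre)
  finally show ?thesis by simp
qed

section \<open>Locality read off dual words\<close>

text \<open>A codeword restricting to the unit vector at \<open>i\<close> would agree with the zero
  word on \<open>R\<close> but not at \<open>i\<close>. So the unit vector is not in the restricted
  code, and by biduality some word of the dual of that code pairs nontrivially with it, that is, is
  nonzero at \<open>i\<close>.\<close>

lemma recovers_imp_dual_word: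
  assumes "finite I" and C: "linear_code K I C" and "i \<in> I" and rec: "recovers I C i R"
  obtains w where "w \<in> dual_code K I C" "w i \<noteq> 0" "{j\<in>I. w j \<noteq> 0} \<subseteq> insert i R"
proof -
  have R: "R \<subseteq> I - {i}" using rec by (simp add: recovers_def)
  define S where "S = insert i R"
  have S: "S \<subseteq> I" "finite S" using R \<open>i \<in> I\<close> finite_subset[OF _ \<open>finite I\<close>] by (auto simp: S_def)
  let ?D = "restr S ` C"
  note D = linear_code_restr[OF C S(1)]
  define e where "e = (\<lambda>j. if j = i then 1 else (0 :: 'a))"
  have "e \<notin> ?D"
  proof
    assume "e \<in> ?D"
    then obtain c where c: "c \<in> C" "e = restr S c" by auto
    have "c j = 0" if "j \<in> R" for j
    proof -
      have "j \<noteq> i" using that R by auto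
      then show ?thesis using fun_cong[OF c(2), of j] that by (simp add: e_def restr_def S_def)
    qed
    moreover have "(\<forall>j\<in>R. c j = 0) \<longrightarrow> c i = 0"
      using bspec[OF bspec[OF conjunct2[OF rec[unfolded recovers_def]] c(1)] linear_codeD(2)[OF C]] .
    ultimately have "c i = 0" by simp
    then show False using fun_cong[OF c(2), of i] by (simp add: e_def restr_def S_def)
  qed
  then have "e \<notin> dual_code K S (dual_code K S ?D)" by (simp only: bidual[OF S(2) D] not_False_eq_True)
  moreover have "e \<in> vecs K S" by (auto simp: e_def vecs_altdef S_def)
  ultimately obtain w where w: "w \<in> dual_code K S ?D" "inner S w e \<noteq> 0"
    unfolding dual_code_altdef[of S "dual_code K S ?D"] by blast
  have "w i \<noteq> 0"
  proof
    assume "w i = 0"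
    then have "inner S w e = 0" unfolding inner_def e_def by (intro sum.neutral) auto
    with w(2) show False by simp
  qed
  moreover have "{j\<in>I. w j \<noteq> 0} \<subseteq> insert i R"
    using w(1) by (auto simp: dual_code_altdef vecs_altdef S_def)
  ultimately show thesis
    using that w(1) dual_restr_iff[OF \<open>finite I\<close> S(1)] by blast
qed

text \<open>The parity check \<open>w\<close> is solved for coordinate \<open>i\<close>: if two
  codewords agree on the rest of its support, their difference pairs with \<open>w\<close> to
  \<open>(c i - d i) * w i\<close>.\<close>

lemma dual_word_imp_recovers:
  assumes "finite I" and C: "linear_code K I C" and "i \<in> I"
    and w: "w \<in> dual_code K I C" "w i \<noteq> 0"
  shows "recovers I C i ({j\<in>I. w j \<noteq> 0} - {i})"
  unfolding recovers_def
proof (intro conjI ballI impI)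
  show "{j \<in> I. w j \<noteq> 0} - {i} \<subseteq> I - {i}" by auto
  fix c d assume "c \<in> C" "d \<in> C" and eq: "\<forall>j\<in>{j \<in> I. w j \<noteq> 0} - {i}. c j = d j"
  then have "inner I (\<lambda>j. c j - d j) w = 0"
    using linear_codeD(5)[OF C] w(1) by (simp add: dual_code_altdef)
  moreover have "inner I (\<lambda>j. c j - d j) w = (\<Sum>j\<in>{i}. (c j - d j) * w j)"
    unfolding inner_def using \<open>finite I\<close> \<open>i \<in> I\<close> eq
    by (intro sum.mono_neutral_right) auto
  ultimately show "c i = d i" using w(2) by simp
qed

text \<open>A recovery set of size \<open>r'\<close> yields a dual word of weight at most
  \<open>r' + 1\<close> through the coordinate. Hence the locality is one less than the dual
  distance as soon as the lightest dual words cover every coordinate.\<close>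

lemma locality_eqI:
  assumes "finite I" and C: "linear_code K I C" and "I \<noteq> {}"
    and low: "\<And>w. w \<in> dual_code K I C \<Longrightarrow> w \<noteq> (\<lambda>i. 0) \<Longrightarrow> wt I w \<ge> Suc r"
    and ex: "\<And>i. i \<in> I \<Longrightarrow> \<exists>w \<in> dual_code K I C. w i \<noteq> 0 \<and> wt I w = Suc r"
  shows "locality I C = r"
  unfolding locality_def
proof (rule Least_equality)
  show "has_locality I C r"
    unfolding has_locality_def
  proof
    fix i assume i: "i \<in> I"
    from ex[OF i] obtain w where w: "w \<in> dual_code K I C" "w i \<noteq> 0" "wt I w = Suc r" by blast
    have "card ({j\<in>I. w j \<noteq> 0} - {i}) = r"
      using w i \<open>finite I\<close> by (simp add: wt_def)
    then show "\<exists>R. card R = r \<and> recovers I C i R"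
      using dual_word_imp_recovers[OF assms(1) C i w(1,2)] by blast
  qed
next
  fix r' assume "has_locality I C r'"
  from \<open>I \<noteq> {}\<close> obtain i where i: "i \<in> I" by auto
  with \<open>has_locality I C r'\<close> obtain R where R: "card R = r'" "recovers I C i R"
    unfolding has_locality_def by blast
  have "finite R" using R(2) \<open>finite I\<close> unfolding recovers_def by (meson finite_Diff finite_subset)
  obtain w where w: "w \<in> dual_code K I C" "w i \<noteq> 0" "{j\<in>I. w j \<noteq> 0} \<subseteq> insert i R"
    by (rule recovers_imp_dual_word[OF assms(1) C i R(2)])
  have "wt I w \<le> card (insert i R)"
    unfolding wt_def using w(3) \<open>finite R\<close> by (intro card_mono) auto
  also have "\<dots> \<le> Suc r'" using R(1) \<open>finite R\<close> by (simp add: card_insert_if)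
  finally show "r \<le> r'" using low[OF w(1)] w(2) by force
qed

section \<open>Code parameters and the Singleton and Plotkin bounds\<close>

lemma min_dist_eqI:
  assumes "finite I" and C: "linear_code K I C"
    and low: "\<And>c. c \<in> C \<Longrightarrow> c \<noteq> (\<lambda>i. 0) \<Longrightarrow> wt I c \<ge> d"
    and ex: "c0 \<in> C" "c0 \<noteq> (\<lambda>i. 0)" "wt I c0 = d"
  shows "min_dist I C = d"
  unfolding min_dist_def
proof (rule Min_eqI)
  show "finite {wt I c |c. c \<in> C \<and> c \<noteq> (\<lambda>i. 0)}"
    using linear_code_finite[OF assms(1) C] by simp
qed (use assms in auto)

text \<open>The upper bound also supplies the finiteness that \<open>Max\<close> presupposes, and it
  turns the lower estimate for \<open>C\<close> into an equality.\<close>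

lemma kopt_eqI:
  assumes C: "linear_code K {..<n} C" "\<And>c. c \<in> C \<Longrightarrow> c \<noteq> (\<lambda>i. 0) \<Longrightarrow> wt {..<n} c \<ge> d"
    and dim: "k \<le> code_dim K C"
    and bound: "\<And>C. linear_code K {..<n} C \<Longrightarrow> (\<And>c. c \<in> C \<Longrightarrow> c \<noteq> (\<lambda>i. 0) \<Longrightarrow> wt {..<n} c \<ge> d)
      \<Longrightarrow> code_dim K C \<le> k"
  shows "kopt K n d = k"
  unfolding kopt_def
proof (rule Max_eqI)
  let ?A = "{code_dim K C | C :: (nat \<Rightarrow> 'a) set.
       linear_code K {..<n} C \<and> (\<forall>c\<in>C. c \<noteq> (\<lambda>i. 0) \<longrightarrow> wt {..<n} c \<ge> d)}"
  show le: "x \<le> k" if "x \<in> ?A" for x using that bound by blast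
  show "finite ?A" by (rule finite_subset[of _ "{..k}"]) (use le in auto)
  have "code_dim K C = k" using dim bound[OF C] by simp
  then show "k \<in> ?A" using C by blast
qed

text \<open>A codeword vanishing on \<open>card I + 1 - d\<close> positions has weight below
  \<open>d\<close>, so restriction to such a set of positions is injective on the code.\<close>

lemma singleton_bound:
  assumes "finite I" and C: "linear_code K I C" and "0 < d" "d \<le> card I"
    and low: "\<And>c. c \<in> C \<Longrightarrow> c \<noteq> (\<lambda>i. 0) \<Longrightarrow> wt I c \<ge> d"
  shows "code_dim K C \<le> card I + 1 - d"
proof -
  have "card I + 1 - d \<le> card I" using \<open>0 < d\<close> by simp
  then obtain S where S: "S \<subseteq> I" "card S = card I + 1 - d" "finite S"
    by (rule obtain_subset_with_card_n)
  have "{c \<in> C. \<forall>i\<in>S. c i = 0} = {\<lambda>i. 0}"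
  proof -
    have "c = (\<lambda>i. 0)" if "c \<in> C" "\<forall>i\<in>S. c i = 0" for c
    proof (rule ccontr)
      assume "c \<noteq> (\<lambda>i. 0)"
      then have "d \<le> wt I c" using low that by blast
      also have "\<dots> \<le> card (I - S)"
        unfolding wt_def using that \<open>finite I\<close> by (intro card_mono) auto
      also have "\<dots> = card I - card S" using S by (simp add: card_Diff_subset)
      finally show False using S(2) \<open>0 < d\<close> \<open>d \<le> card I\<close> by simp
    qed
    then have "{c \<in> C. \<forall>i\<in>S. c i = 0} \<subseteq> {\<lambda>i. 0}" by blast
    moreover have "{\<lambda>i. 0} \<subseteq> {c \<in> C. \<forall>i\<in>S. c i = 0}" using linear_codeD(2)[OF C] by simp
    ultimately show ?thesis by (rule equalityI)
  qed
  then have "card C = card (restr S ` C)"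
    using card_restr[OF assms(1) C, of S] by simp
  also have "\<dots> \<le> p ^ card S"
    using card_mono[OF card_vecs(1)[OF S(3)] linear_codeD(1)[OF linear_code_restr[OF C S(1)]]]
    by (simp add: card_vecs(2)[OF S(3)])
  finally have "p ^ code_dim K C \<le> p ^ card S"
    using card_eq_power_code_dim(1)[OF assms(1) C] by simp
  then show ?thesis using S(2) p_gt_1 by simp
qed

text \<open>Double count of the total weight. Restriction to one coordinate has at most
  \<open>p\<close> values, so at least a \<open>1/p\<close> share of the code vanishes there. The
  inequality is multiplied by \<open>p\<close> to stay within natural numbers.\<close>

lemma plotkin_bound:
  assumes "finite I" and C: "linear_code K I C"
    and low: "\<And>c. c \<in> C \<Longrightarrow> c \<noteq> (\<lambda>i. 0) \<Longrightarrow> wt I c \<ge> d"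
  shows "p * (d * (card C - 1)) \<le> card I * ((p - 1) * card C)"
proof -
  note fin = linear_code_finite[OF assms(1) C]
  have coord: "p * card {c \<in> C. c i \<noteq> 0} \<le> (p - 1) * card C" if "i \<in> I" for i
  proof -
    let ?N = "card {c \<in> C. \<forall>j\<in>{i}. c j = 0}"
    have "card (restr {i} ` C) \<le> p"
      using card_mono[OF card_vecs(1) linear_codeD(1)[OF linear_code_restr[OF C, of "{i}"]]] that
      by (simp add: card_vecs(2))
    then have "card (restr {i} ` C) * ?N \<le> p * ?N" by (rule mult_le_mono1)
    then have "card C \<le> p * ?N" unfolding card_restr[OF assms(1) C] .
    moreover have "{c \<in> C. c i \<noteq> 0} = C - {c \<in> C. \<forall>j\<in>{i}. c j = 0}" by auto
    then have "card {c \<in> C. c i \<noteq> 0} = card C - ?N"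
      using fin by (simp add: card_Diff_subset)
    ultimately show ?thesis
      by (simp add: diff_mult_distrib diff_mult_distrib2 diff_le_mono2)
  qed
  have "d * (card C - 1) = (\<Sum>c\<in>C - {\<lambda>i. 0}. d)"
    using linear_codeD(2)[OF C] fin by simp
  also have "\<dots> \<le> (\<Sum>c\<in>C - {\<lambda>i. 0}. wt I c)"
    by (rule sum_mono) (use low in auto)
  also have "\<dots> \<le> (\<Sum>c\<in>C. wt I c)"
    by (rule sum_mono2) (use fin in auto)
  also have "\<dots> = (\<Sum>c\<in>C. \<Sum>i\<in>I. if c i \<noteq> 0 then 1 else 0)"
    using assms(1) by (simp add: wt_def sum.If_cases Int_def)
  also have "\<dots> = (\<Sum>i\<in>I. card {c \<in> C. c i \<noteq> 0})"
    using fin by (subst sum.swap) (simp add: sum.If_cases Int_def)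
  finally have "p * (d * (card C - 1)) \<le> p * (\<Sum>i\<in>I. card {c \<in> C. c i \<noteq> 0})" by simp
  also have "\<dots> = (\<Sum>i\<in>I. p * card {c \<in> C. c i \<noteq> 0})" by (rule sum_distrib_left)
  also have "\<dots> \<le> (\<Sum>i\<in>I. (p - 1) * card C)" by (rule sum_mono) (fact coord)
  finally show ?thesis by simp
qed

text \<open>\<open>kopt\<close> ranges over codes indexed by \<open>{..<n}\<close>; this carries a
  code indexed by field elements over to that range.\<close>

lemma reindex_code:
  assumes "finite Z" and C: "linear_code K Z C" and "card Z = n"
    and low: "\<And>c. c \<in> C \<Longrightarrow> c \<noteq> (\<lambda>i. 0) \<Longrightarrow> wt Z c \<ge> d"
  obtains C' where "linear_code K {..<n} C'" "card C' = card C"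
    "\<And>c. c \<in> C' \<Longrightarrow> c \<noteq> (\<lambda>i. 0) \<Longrightarrow> wt {..<n} c \<ge> d"
proof -
  obtain g where g: "bij_betw g {..<n} Z"
    using ex_bij_betw_nat_finite[OF assms(1)] \<open>card Z = n\<close> by (auto simp: atLeast0LessThan)
  define T where "T = (\<lambda>(c :: 'b \<Rightarrow> 'a) i. if i < n then c (g i) else 0)"
  have gZ: "g i \<in> Z" if "i < n" for i using g that by (auto simp: bij_betw_def)
  have wt_T: "wt {..<n} (T c) = wt Z c" for c
    unfolding wt_def
  proof (rule bij_betw_same_card[of g])
    show "bij_betw g {i \<in> {..<n}. T c i \<noteq> 0} {i \<in> Z. c i \<noteq> 0}"
      using g by (auto simp: bij_betw_def inj_on_def T_def)
  qed
  have T_eq: "c = d" if "c \<in> C" "d \<in> C" "T c = T d" for c d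
  proof
    fix z
    show "c z = d z"
    proof (cases "z \<in> Z")
      case True
      then obtain i where "i < n" "z = g i" using g by (auto simp: bij_betw_def)
      then show ?thesis using fun_cong[OF that(3), of i] by (simp add: T_def)
    next
      case False
      then have "c z = 0" "d z = 0" using that(1,2) linear_codeD(1)[OF C] by (auto simp: vecs_altdef)
      then show ?thesis by simp
    qed
  qed
  have T0: "T (\<lambda>i. 0) = (\<lambda>i. 0)" by (auto simp: T_def)
  show thesis
  proof
    show "linear_code K {..<n} (T ` C)"
      unfolding linear_code_def
    proof (intro conjI ballI)
      show "T ` C \<subseteq> vecs K {..<n}"
        using linear_codeD(1)[OF C] gZ by (auto simp: T_def vecs_altdef)
      show "(\<lambda>i. 0) \<in> T ` C" using T0 linear_codeD(2)[OF C] by (metis image_eqI)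
    next
      fix c d assume "c \<in> T ` C" "d \<in> T ` C"
      then obtain c' d' where cd: "c' \<in> C" "d' \<in> C" "c = T c'" "d = T d'" by auto
      then have "(\<lambda>i. c i + d i) = T (\<lambda>i. c' i + d' i)" by (auto simp: T_def)
      then show "(\<lambda>i. c i + d i) \<in> T ` C" using linear_codeD(3)[OF C cd(1,2)] by simp
    next
      fix a c assume "a \<in> K" "c \<in> T ` C"
      then obtain c' where cd: "c' \<in> C" "c = T c'" by auto
      then have "(\<lambda>i. a * c i) = T (\<lambda>i. a * c' i)" by (auto simp: T_def)
      then show "(\<lambda>i. a * c i) \<in> T ` C" using linear_codeD(4)[OF C \<open>a \<in> K\<close> cd(1)] by simp
    qed
    show "card (T ` C) = card C"
      by (rule card_image) (auto simp: inj_on_def intro: T_eq)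
    fix c assume "c \<in> T ` C" "c \<noteq> (\<lambda>i. 0)"
    then obtain c' where "c' \<in> C" "c = T c'" "c' \<noteq> (\<lambda>i. 0)" using T0 by auto
    then show "wt {..<n} c \<ge> d" using low by (simp add: wt_T)
  qed
qed

end

section \<open>Value distribution of the bent function\<close>

text \<open>Translation by 1 permutes the field, so comparing sums of all elements shows that
  \<open>p ^ 2\<close> is zero in it. The characteristic is then a prime divisor of
  \<open>p ^ 2\<close>.\<close>

lemma CHAR_eq_prime:
  assumes "prime p" "card (UNIV :: 'a::{field,finite} set) = p ^ 2"
  shows "CHAR('a) = p"
proof -
  have "(\<Sum>x\<in>UNIV. x :: 'a) = (\<Sum>x\<in>UNIV. x + 1)"
    by (rule sum.reindex_bij_witness[of _ "\<lambda>x. x + 1" "\<lambda>x. x - 1"]) auto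
  also have "\<dots> = (\<Sum>x\<in>UNIV. x) + of_nat (card (UNIV :: 'a set))"
    by (simp add: sum.distrib)
  finally have "(of_nat (p ^ 2) :: 'a) = 0" by (simp add: assms(2))
  then have dvd: "CHAR('a) dvd p ^ 2" using of_nat_eq_0_iff_char_dvd by blast
  have "CHAR('a) > 0"
    using dvd prime_gt_0_nat[OF assms(1)] by (intro Nat.gr0I) auto
  then have "prime CHAR('a)" by (rule prime_CHAR_semidom)
  then show ?thesis
    using dvd assms(1) prime_dvd_power primes_dvd_imp_eq by blast
qed

text \<open>Multiplication by a nonzero \<open>x\<close> permutes the nonzero elements; comparing
  their products gives \<open>x ^ (?n - 1) = 1\<close>.\<close>

lemma finite_field_power_card:
  fixes x :: "'a::{field,finite}"
  shows "x ^ card (UNIV :: 'a set) = x"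
proof (cases "x = 0")
  case False
  let ?n = "card (UNIV :: 'a set)"
  have n: "?n > 0" by (simp add: card_gt_0_iff)
  have "(\<Prod>y\<in>UNIV-{0}. y) = (\<Prod>y\<in>UNIV-{0}. x * y)"
    by (rule prod.reindex_bij_witness[of _ "\<lambda>y. x * y" "\<lambda>y. y / x"]) (use False in auto)
  also have "\<dots> = x ^ (?n - 1) * (\<Prod>y\<in>UNIV-{0}. y)"
    by (simp add: prod.distrib)
  finally have "x ^ (?n - 1) = 1" by simp
  then have "x * x ^ (?n - 1) = x" by simp
  then show ?thesis using n by (metis Suc_pred' power_Suc)
qed (simp add: card_gt_0_iff)

locale quadratic_extension = prime_subfield p K for p :: nat and K :: "'a::{field,finite} set" +
  assumes odd_p: "odd p" and card_field: "card (UNIV :: 'a set) = p ^ 2"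
begin

lemma p_ge_3: "p \<ge> 3"
  using odd_p p_gt_1 by (cases "p = 2") auto

section \<open>The trace and counts of values\<close>

lemma tr_eq: "tr p 2 (x :: 'a) = x + x ^ p"
  by (simp add: tr_def numeral_2_eq_2)

lemma frobenius_add: "(x + y :: 'a) ^ p = x ^ p + y ^ p"
  by (rule freshmans_dream) (simp_all add: char_p prime_p)

lemma tr_in_K: "tr p 2 (x :: 'a) \<in> K"
proof -
  have "(x ^ p) ^ p = x"
    using finite_field_power_card[of x] by (simp add: card_field power2_eq_square power_mult)
  then show ?thesis by (simp add: K_def Fp_def tr_eq frobenius_add add.commute)
qed

lemma tr_0 [simp]: "tr p 2 (0 :: 'a) = 0"
  using p_gt_0 by (simp add: tr_eq)

lemma tr_add: "tr p 2 (x + y :: 'a) = tr p 2 x + tr p 2 y"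
  by (simp add: tr_eq frobenius_add)

lemma tr_scale: "a \<in> K \<Longrightarrow> tr p 2 (a * x) = a * tr p 2 x"
  by (simp add: tr_eq power_mult_distrib K_def Fp_def algebra_simps)

lemma sum_fibres_K:
  fixes g :: "'b::finite \<Rightarrow> 'a" and h :: "'a \<Rightarrow> 'c::comm_semiring_1"
  assumes "\<And>x. g x \<in> K"
  shows "(\<Sum>x\<in>UNIV. h (g x)) = (\<Sum>t\<in>K. of_nat (card {x. g x = t}) * h t)"
proof -
  have "(\<Sum>x\<in>UNIV. h (g x)) = (\<Sum>t\<in>K. \<Sum>x\<in>{x\<in>UNIV. g x = t}. h (g x))"
    by (rule sum.group[symmetric]) (use assms in auto)
  also have "\<dots> = (\<Sum>t\<in>K. of_nat (card {x. g x = t}) * h t)"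
    by (intro sum.cong) auto
  finally show ?thesis .
qed

lemma card_fibres_K:
  fixes g :: "'b::finite \<Rightarrow> 'a"
  assumes "\<And>x. g x \<in> K"
  shows "(\<Sum>t\<in>K. card {x. g x = t}) = card (UNIV :: 'b set)"
  using sum_fibres_K[of g "\<lambda>_. 1 :: nat"] assms by simp

lemma sum_K: "(\<Sum>t\<in>K. h t) = (\<Sum>j<p. h (of_nat j))"
  unfolding K_eq_of_nat by (simp add: sum.reindex[OF inj_of_nat])

text \<open>A trace fibre is the root set of X^p + X - t, so it has at most \<open>p\<close>
  elements; the \<open>p\<close> fibres together have \<open>p ^ 2\<close>, so none is smaller. The
  factor \<open>b\<close> only permutes the field.\<close>

lemma card_trace_fibre:
  assumes "b \<noteq> 0" "c \<in> K"
  shows "card {x. tr p 2 (b * x) = c} = p"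
proof -
  have le: "card {x :: 'a. tr p 2 x = t} \<le> p" for t
  proof -
    let ?P = "monom 1 p + monom 1 1 - [:t:] :: 'a poly"
    have "coeff ?P p = 1" using p_gt_1 by (simp add: coeff_pCons split: nat.splits)
    then have "?P \<noteq> 0" by (metis coeff_0 zero_neq_one)
    have "card {x :: 'a. tr p 2 x = t} \<le> degree ?P"
      by (rule card_roots_le[OF \<open>?P \<noteq> 0\<close>]) (auto simp: tr_eq poly_monom)
    also have "degree ?P \<le> p"
      using p_gt_1 by (intro degree_diff_le degree_add_le) (auto simp: degree_monom_eq)
    finally show ?thesis .
  qed
  have sum: "(\<Sum>t\<in>K. card {x :: 'a. tr p 2 x = t}) = p ^ 2"
    using card_fibres_K[of "tr p 2 :: 'a \<Rightarrow> 'a"] tr_in_K by (simp add: card_field)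
  have eq: "card {x :: 'a. tr p 2 x = c} = p"
  proof (rule ccontr)
    assume "card {x :: 'a. tr p 2 x = c} \<noteq> p"
    then have "(\<Sum>t\<in>K. card {x :: 'a. tr p 2 x = t}) < (\<Sum>t\<in>K. p)"
      using le by (intro sum_strict_mono_ex1) (auto intro!: bexI[of _ c] assms simp: le_neq_implies_less)
    then show False using sum by (simp add: card_K power2_eq_square)
  qed
  have "bij_betw (\<lambda>x. b * x) {x. tr p 2 (b * x) = c} {x. tr p 2 x = c}"
    by (rule bij_betw_byWitness[where f' = "\<lambda>x. x / b"]) (use assms(1) in auto)
  then show ?thesis using eq by (metis bij_betw_same_card)
qed

section \<open>The sign condition and the fibres of the bent function\<close>

lemma neg_1_neq_1: "(-1 :: 'a) \<noteq> 1"
proof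
  assume "(-1 :: 'a) = 1"
  then have "(of_nat 2 :: 'a) = of_nat 0" by (simp add: eq_neg_iff_add_eq_0)
  then show False using p_ge_3 by (simp add: of_nat_eq_iff_mod del: of_nat_0 of_nat_numeral)
qed

text \<open>Makes the sign condition explicit: it determines \<epsilon> from \<open>p mod 4\<close>,
  matching the case distinction in \<open>sqrt_pstar\<close>.\<close>

lemma eta0_neg_1: "eta0 p (-1 :: 'a) = (if p mod 4 = 1 then 1 else -1)"
proof -
  have "(\<exists>y\<in>K. y ^ 2 = -1) \<longleftrightarrow> p mod 4 = 1"
  proof
    assume "\<exists>y\<in>K. y ^ 2 = -1"
    then obtain y :: 'a where y: "y ^ p = y" "y ^ 2 = -1" by (auto simp: K_def Fp_def)
    have "y \<noteq> 0" using y(2) by auto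
    \<comment> \<open>Substituting \<open>y ^ 2 = -1\<close> into \<open>y ^ p = y\<close> shows
      that \<open>p div 2\<close> is even.\<close>
    have "p = 2 * (p div 2) + 1" using odd_p by simp
    then have "y = y ^ (2 * (p div 2) + 1)" using y(1) by simp
    also have "\<dots> = (-1) ^ (p div 2) * y" unfolding power_add power_mult y(2) by simp
    finally have "(-1 :: 'a) ^ (p div 2) = 1" using \<open>y \<noteq> 0\<close> by simp
    then have "even (p div 2)" using neg_1_neq_1 by (cases "even (p div 2)") auto
    then show "p mod 4 = 1" using odd_p by presburger
  next
    assume "p mod 4 = 1"
    define n where "n = (p - 1) div 4"
    have n: "p = 4 * n + 1" "n > 0"
      using \<open>p mod 4 = 1\<close> p_ge_3 unfolding n_def by presburger+
    let ?P = "monom 1 (2 * n) - 1 :: 'a poly"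
    have "coeff ?P (2 * n) = 1" using n by simp
    then have "?P \<noteq> 0" by (metis coeff_0 zero_neq_one)
    have "degree ?P \<le> 2 * n" by (intro degree_diff_le) (auto simp: degree_monom_eq)
    \<comment> \<open>\<open>K\<close> has \<open>4 * n\<close> nonzero elements, too many for
      X^(2n) - 1. For a \<open>y\<close> that is not a root, \<open>y ^ (2 * n)\<close> is -1, and
      \<open>y ^ n\<close> is the wanted square root.\<close>
    have "\<exists>y\<in>K - {0}. y ^ (2 * n) \<noteq> 1"
    proof (rule ccontr)
      assume "\<not> (\<exists>y\<in>K - {0}. y ^ (2 * n) \<noteq> 1)"
      then have "card (K - {0}) \<le> degree ?P"
        by (intro card_roots_le[OF \<open>?P \<noteq> 0\<close>]) (auto simp: poly_monom)
      then show False using \<open>degree ?P \<le> 2 * n\<close> n by (simp add: card_K)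
    qed
    then obtain y where y: "y \<in> K" "y \<noteq> 0" "y ^ (2 * n) \<noteq> 1" by auto
    have "y ^ (4 * n) * y = y" using y(1) n by (simp add: K_def Fp_def)
    then have "(y ^ (2 * n)) ^ 2 = 1" using y(2) by (simp flip: power_mult)
    then have "y ^ (2 * n) = -1" using y(3) by (simp add: power2_eq_1_iff)
    then have "(y ^ n) ^ 2 = -1" by (simp add: mult.commute flip: power_mult)
    moreover have "y ^ n \<in> K" by (induction n) (use y(1) in auto)
    ultimately show "\<exists>y\<in>K. y ^ 2 = -1" by blast
  qed
  then show ?thesis by (simp add: eta0_def K_def)
qed

text \<open>The Walsh coefficient at \<open>b\<close>, sorted by values of \<open>f - tr\<close>, is
  an integral relation between powers of \<open>z\<close>. Such a relation has all coefficients
  equal, and their total fixes the common value.\<close>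

lemma weakly_regular_bent_fibres:
  assumes bent: "weakly_regular_bent p 2 f \<epsilon>" and sign: "\<epsilon> * eta0 p (-1 :: 'a) = -1"
  obtains s where "s \<in> K"
    "\<And>t. t \<in> K \<Longrightarrow> card {x :: 'a. f x - tr p 2 (b * x) = t} = (if t = s then 1 else p + 1)"
proof -
  from bent obtain fs :: "'a \<Rightarrow> 'a" where f: "\<And>x. f x \<in> K" and fs: "fs b \<in> K"
    and walsh: "(\<Sum>x\<in>UNIV. zeta_pow p (f x - tr p 2 (b * x))) = of_int \<epsilon> * sqrt_pstar p ^ 2 * zeta_pow p (fs b)"
    unfolding weakly_regular_bent_def K_def by blast
  define g where "g = (\<lambda>x. f x - tr p 2 (b * x))"
  define z where "z = cis (2 * pi / real p)"
  define N where "N = (\<lambda>j. card {x. g x = of_nat j})"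
  have g: "g x \<in> K" for x unfolding g_def using f tr_in_K by (intro K_diff) auto
  from fs obtain s where s: "s < p" "fs b = of_nat s" by (rule K_cases)
  \<comment> \<open>The square of \<open>sqrt_pstar p\<close> is \<open>p\<close> times
    \<open>eta0 p (-1)\<close>, so the sign condition leaves \<open>-p\<close> in both residue
    classes.\<close>
  have "of_int \<epsilon> * sqrt_pstar p ^ 2 = - (of_nat p :: complex)"
  proof (cases "p mod 4 = 1")
    case True
    then have "\<epsilon> = -1" using sign by (simp add: eta0_neg_1)
    then show ?thesis using True by (simp add: sqrt_pstar_def flip: of_real_power)
  next
    case False
    then have "\<epsilon> = 1" using sign by (simp add: eta0_neg_1)
    then show ?thesis using False by (simp add: sqrt_pstar_def power_mult_distrib flip: of_real_power)
  qed
  then have "(\<Sum>x\<in>UNIV. zeta_pow p (g x)) = - of_nat p * z ^ s"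
    using walsh s by (simp add: g_def zeta_pow_of_nat z_def)
  moreover have "(\<Sum>x\<in>UNIV. zeta_pow p (g x)) = (\<Sum>j<p. of_nat (N j) * z ^ j)"
    using sum_fibres_K[of g "zeta_pow p"] g by (simp add: sum_K N_def zeta_pow_of_nat z_def)
  ultimately have walsh': "(\<Sum>j<p. of_nat (N j) * z ^ j) = - of_nat p * z ^ s" by simp
  \<comment> \<open>Moving \<open>-p * z ^ s\<close> to the left adds \<open>p\<close> to the count
    at \<open>s\<close>. The \<open>p\<close> equal coefficients then sum to
    \<open>p ^ 2 + p\<close>, so each is \<open>p + 1\<close>, and the count at \<open>s\<close>
    alone drops to 1.\<close>
  define m where "m = (\<lambda>j. int (N j) + (if j = s then int p else 0))"
  have "(\<Sum>j<p. of_int (m j) * z ^ j) = (\<Sum>j<p. of_nat (N j) * z ^ j + (if j = s then of_nat p * z ^ j else 0))"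
    by (intro sum.cong) (auto simp: m_def algebra_simps)
  also have "\<dots> = 0"
    using s(1) by (simp add: sum.distrib walsh')
  finally have m_eq: "m i = m (p - 1)" if "i < p" for i
    using prime_root_of_unity_relation[OF prime_p _ _ _ that, of z m] cis_power_p cis_neq_1
    by (simp add: z_def)
  have "(\<Sum>j<p. int (N j)) = int p ^ 2"
    using card_fibres_K[of g] g by (simp add: sum_K N_def card_field flip: of_nat_sum)
  then have "(\<Sum>j<p. m j) = int p * (int p + 1)"
    using s(1) by (simp add: m_def sum.distrib algebra_simps power2_eq_square)
  moreover have "(\<Sum>j<p. m j) = (\<Sum>j<p. m (p - 1))"
    by (intro sum.cong refl m_eq) simp
  ultimately have "m (p - 1) = int p + 1" using p_gt_0 by simp
  then have m: "m j = int p + 1" if "j < p" for j using m_eq[OF that] by simp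
  show thesis
  proof (rule that[OF fs])
    fix t assume "t \<in> K"
    then obtain j where j: "j < p" "t = of_nat j" by (rule K_cases)
    have "t = fs b \<longleftrightarrow> j = s"
      using inj_of_nat j s by (auto simp: inj_on_def)
    then show "card {x. f x - tr p 2 (b * x) = t} = (if t = fs b then 1 else p + 1)"
      using m[OF j(1)] j(2) by (auto simp: m_def N_def g_def split: if_splits)
  qed
qed

end

section \<open>The code of the bent function\<close>

text \<open>The value distribution is the form in which bentness enters the study of the
  code.\<close>

locale elliptic_function = quadratic_extension p K for p and K :: "'a::{field,finite} set" +
  fixes f :: "'a \<Rightarrow> 'a"
  assumes f_in_K: "f x \<in> K"
    and fibres: "\<exists>s\<in>K. \<forall>t\<in>K. card {x. f x - tr p 2 (b * x) = t} = (if t = s then 1 else p + 1)"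
begin

section \<open>The code, its size and the zeros of its words\<close>

definition word :: "'a \<Rightarrow> 'a \<Rightarrow> 'a \<Rightarrow> 'a \<Rightarrow> 'a" where
  "word a b c = (\<lambda>x. a * f x + tr p 2 (b * x) + c)"

abbreviation C :: "('a \<Rightarrow> 'a) set" where "C \<equiv> code_Cf p f"

abbreviation D :: "('a \<Rightarrow> 'a) set" where "D \<equiv> dual_code K UNIV C"

lemma code_Cf_eq: "C = {word a b c | a b c. a \<in> K \<and> c \<in> K}"
  by (simp add: code_Cf_def word_def K_def)

lemma word_add: "(\<lambda>x. word a b c x + word a' b' c' x) = word (a + a') (b + b') (c + c')"
  by (simp add: word_def algebra_simps tr_add)

lemma word_scale: "t \<in> K \<Longrightarrow> (\<lambda>x. t * word a b c x) = word (t * a) (t * b) (t * c)"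
  by (simp add: word_def algebra_simps tr_scale[symmetric])

lemma word_0: "word 0 0 0 = (\<lambda>x. 0)"
  by (simp add: word_def)

lemma linear_code_C: "linear_code K UNIV C"
  unfolding linear_code_def
proof (intro conjI ballI)
  show "C \<subseteq> vecs K UNIV"
    using f_in_K tr_in_K by (auto simp: code_Cf_eq vecs_def word_def)
  show "(\<lambda>i. 0) \<in> C"
    unfolding code_Cf_eq using word_0 by (metis (mono_tags, lifting) K_0 mem_Collect_eq)
next
  fix u v assume "u \<in> C" "v \<in> C"
  then obtain a b c a' b' c' where "u = word a b c" "v = word a' b' c'" "a \<in> K" "c \<in> K" "a' \<in> K" "c' \<in> K"
    unfolding code_Cf_eq by blast
  then show "(\<lambda>x. u x + v x) \<in> C"
    unfolding code_Cf_eq by (auto simp only: word_add K_add)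
next
  fix t u assume "t \<in> K" "u \<in> C"
  then obtain a b c where "u = word a b c" "a \<in> K" "c \<in> K"
    unfolding code_Cf_eq by blast
  then show "(\<lambda>x. t * u x) \<in> C"
    unfolding code_Cf_eq using \<open>t \<in> K\<close> by (auto simp only: word_scale K_mult)
qed

text \<open>For \<open>a \<noteq> 0\<close>, dividing by \<open>a\<close> turns the zero set into a
  fibre of \<open>f - tr\<close>, of size 1 or \<open>p + 1\<close>. For \<open>a = 0\<close> it is
  a trace fibre of size \<open>p\<close>, or empty.\<close>

lemma zeros_word_le:
  assumes "a \<in> K" "c \<in> K" and nz: "a \<noteq> 0 \<or> b \<noteq> 0 \<or> c \<noteq> 0"
  shows "card {x. word a b c x = 0} \<le> p + 1"
proof -
  consider "a \<noteq> 0" | "a = 0" "b \<noteq> 0" | "a = 0" "b = 0" "c \<noteq> 0" using nz by blast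
  then show ?thesis
  proof cases
    case 1
    have ia: "- inverse a \<in> K" using assms(1) by auto
    have "word a b c x = 0 \<longleftrightarrow> f x - tr p 2 ((- inverse a * b) * x) = - inverse a * c" for x
    proof -
      have "tr p 2 ((- inverse a * b) * x) = - inverse a * tr p 2 (b * x)"
        using tr_scale[OF ia, of "b * x"] by (simp add: mult.assoc)
      moreover have "f x + inverse a * T = - inverse a * c \<longleftrightarrow> a * f x + T + c = 0" for T
        using 1 by (auto simp: field_simps eq_neg_iff_add_eq_0)
      ultimately show ?thesis by (simp add: word_def)
    qed
    moreover have "- inverse a * c \<in> K" using ia assms(2) by (rule K_mult)
    ultimately show ?thesis using fibres[of "- inverse a * b"] by auto
  next
    case 2
    have "word a b c x = 0 \<longleftrightarrow> tr p 2 (b * x) = - c" for x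
      using 2 by (simp add: word_def eq_neg_iff_add_eq_0)
    then show ?thesis using card_trace_fibre[OF 2(2) K_uminus[OF assms(2)]] by simp
  next
    case 3
    then show ?thesis by (simp add: word_def)
  qed
qed

lemma p_plus_1_less: "p + 1 < p ^ 2"
proof -
  have "p * 3 \<le> p * p" using p_ge_3 by (rule mult_le_mono2)
  then show ?thesis unfolding power2_eq_square using p_ge_3 by linarith
qed

lemma word_eq_0_iff:
  assumes "a \<in> K" "c \<in> K"
  shows "word a b c = (\<lambda>x. 0) \<longleftrightarrow> a = 0 \<and> b = 0 \<and> c = 0"
proof
  assume "word a b c = (\<lambda>x. 0)"
  then have "card {x. word a b c x = 0} = p ^ 2" by (simp add: card_field)
  then show "a = 0 \<and> b = 0 \<and> c = 0"
    using zeros_word_le[OF assms, of b] p_plus_1_less by linarith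
qed (simp add: word_0)

lemma card_C: "card C = p ^ 4"
proof -
  have "a = a' \<and> b = b' \<and> c = c'"
    if K: "a \<in> K" "c \<in> K" "a' \<in> K" "c' \<in> K" and eq: "word a b c = word a' b' c'" for a b c a' b' c'
  proof -
    have "word (a - a') (b - b') (c - c') = (\<lambda>x. word a b c x + (-1) * word a' b' c' x)"
      using word_scale[of "-1" a' b' c'] word_add[of a b c "- a'" "- b'" "- c'"] by (auto simp: fun_eq_iff K_uminus)
    also have "\<dots> = (\<lambda>x. 0)" by (simp add: eq)
    finally show ?thesis
      unfolding word_eq_0_iff[OF K_diff[OF K(1,3)] K_diff[OF K(2,4)]] by simp
  qed
  then have "inj_on (\<lambda>(a, b, c). word a b c) (K \<times> UNIV \<times> K)"
    unfolding inj_on_def by (simp add: split_paired_all split_paired_Ball_Sigma)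
  moreover have "C = (\<lambda>(a, b, c). word a b c) ` (K \<times> UNIV \<times> K)"
    unfolding code_Cf_eq by (auto simp: image_def)
  ultimately have "card C = card (K \<times> (UNIV :: 'a set) \<times> K)" by (simp add: card_image)
  then show ?thesis
    by (simp add: card_cartesian_product card_K card_field power2_eq_square power4_eq_xxxx)
qed

lemma zeros_le:
  assumes "u \<in> C" "u \<noteq> (\<lambda>x. 0)"
  shows "card {x. u x = 0} \<le> p + 1"
proof -
  from assms(1) obtain a b c where u: "u = word a b c" "a \<in> K" "c \<in> K"
    unfolding code_Cf_eq by blast
  then have "a \<noteq> 0 \<or> b \<noteq> 0 \<or> c \<noteq> 0" using assms(2) word_eq_0_iff[OF u(2,3)] by simp
  then show ?thesis unfolding u(1) by (rule zeros_word_le[OF u(2,3)])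
qed

lemma wt_eq: "wt UNIV (u :: 'a \<Rightarrow> 'a) = p ^ 2 - card {x. u x = 0}"
proof -
  have "{x \<in> UNIV. u x \<noteq> 0} = UNIV - {x. u x = 0}" by auto
  then show ?thesis unfolding wt_def by (simp only: card_Diff_subset[OF finite subset_UNIV] card_field)
qed

lemma wt_C_ge:
  assumes "u \<in> C" "u \<noteq> (\<lambda>x. 0)"
  shows "wt UNIV u \<ge> p ^ 2 - p - 1"
  using zeros_le[OF assms] by (simp add: wt_eq)

lemma word_1_in_C: "c \<in> K \<Longrightarrow> word 1 b c \<in> C"
  unfolding code_Cf_eq using K_1 by blast

lemma zeros_word_1: "{x. word 1 (- b) (- t) x = 0} = {x. f x - tr p 2 (b * x) = t}"
proof -
  have "tr p 2 (- b * x) = - tr p 2 (b * x)" for x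
    using tr_scale[of "-1" "b * x"] by (simp add: K_uminus)
  then show ?thesis by (auto simp: word_def algebra_simps)
qed

lemma max_zeros_avoiding:
  obtains u where "u \<in> C" "u x0 \<noteq> 0" "card {x. u x = 0} = p + 1"
proof -
  from fibres[of 0] obtain s where s: "s \<in> K"
    "\<And>t. t \<in> K \<Longrightarrow> card {x. f x - tr p 2 (0 * x) = t} = (if t = s then 1 else p + 1)" by blast
  \<comment> \<open>As \<open>p\<close> is at least 3, some level \<open>t\<close> of
    \<open>f\<close> avoids both the exceptional value and \<open>f x0\<close>.\<close>
  have "card {s, f x0} < card K" using p_ge_3 card_insert_le_m1[of 2 "{f x0}" s] by (simp add: card_K)
  then have "\<not> K \<subseteq> {s, f x0}" by (meson card_mono finite not_less)
  then obtain t where t: "t \<in> K" "t \<noteq> s" "t \<noteq> f x0" by auto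
  show thesis
  proof
    show "word 1 (- 0) (- t) \<in> C" using t by (intro word_1_in_C) auto
    show "card {x. word 1 (- 0) (- t) x = 0} = p + 1"
      unfolding zeros_word_1 using s t by simp
    show "word 1 (- 0) (- t) x0 \<noteq> 0" using t by (simp add: word_def)
  qed
qed

text \<open>If every \<open>f - tr (b \<cdot>)\<close> took its value at \<open>x0\<close> only there, then no \<open>b\<close> would solve
  \<open>tr (b (x1 - x0)) = f x1 - f x0\<close> for a second point \<open>x1\<close>.\<close>

lemma max_zeros_through:
  obtains u where "u \<in> C" "u x0 = 0" "card {x. u x = 0} = p + 1"
proof -
  \<comment> \<open>Taking \<open>x0 + 1\<close> as second point makes the condition on
    \<open>b\<close> a plain trace equation, which has \<open>p\<close> solutions.\<close>
  have "card {b. tr p 2 (1 * b) = f (x0 + 1) - f x0} = p"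
    using f_in_K by (intro card_trace_fibre) auto
  then have "{b. tr p 2 (1 * b) = f (x0 + 1) - f x0} \<noteq> {}" using p_gt_0 by force
  then obtain b where b: "tr p 2 b = f (x0 + 1) - f x0" by auto
  define t where "t = f x0 - tr p 2 (b * x0)"
  have t: "t \<in> K" unfolding t_def using f_in_K tr_in_K by (intro K_diff)
  let ?Z = "{x. f x - tr p 2 (b * x) = t}"
  have "{x0, x0 + 1} \<subseteq> ?Z"
    using b by (simp add: t_def algebra_simps tr_add)
  then have "card {x0, x0 + 1} \<le> card ?Z" by (intro card_mono) auto
  then have "2 \<le> card ?Z" by simp
  moreover have "card ?Z = 1 \<or> card ?Z = p + 1"
    using fibres[of b] t by (metis (no_types, lifting))
  ultimately have "card ?Z = p + 1" by auto
  show thesis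
  proof
    show "word 1 (- b) (- t) \<in> C" using t by (intro word_1_in_C) auto
    show "card {x. word 1 (- b) (- t) x = 0} = p + 1" unfolding zeros_word_1 by fact
    show "word 1 (- b) (- t) x0 = 0" using zeros_word_1[of b t] unfolding t_def by blast
  qed
qed

text \<open>Count the zeros of the \<open>p + 1\<close> members \<open>v\<close> and \<open>u + l v\<close> of the pencil.\<close>

lemma common_zeros_le:
  assumes u: "u \<in> C" and v: "v \<in> C" "v \<noteq> (\<lambda>x. 0)"
    and indep: "\<And>l. l \<in> K \<Longrightarrow> (\<lambda>x. u x + l * v x) \<noteq> (\<lambda>x. 0)"
  shows "card {x. u x = 0 \<and> v x = 0} \<le> 2"
proof -
  let ?m = "card {x. u x = 0 \<and> v x = 0}"
  have K: "w x \<in> K" if "w \<in> C" for w x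
    by (rule vecs_in_K[OF subsetD[OF linear_codeD(1)[OF linear_code_C] that]])
  \<comment> \<open>A point off the zeros of \<open>v\<close> is a zero of exactly one
    \<open>u + l v\<close>; a zero of \<open>v\<close> is a zero of all of them or of none,
    according to \<open>u\<close>.\<close>
  have cnt: "card {l \<in> K. u x + l * v x = 0} = (if v x \<noteq> 0 then 1 else if u x = 0 then p else 0)" for x
  proof (cases "v x = 0")
    case False
    then have "{l \<in> K. u x + l * v x = 0} = {- u x / v x}"
      using K[OF u, of x] K[OF v(1), of x] by (auto simp: field_simps eq_neg_iff_add_eq_0)
    then show ?thesis using False by simp
  qed (simp add: card_K)
  have "(\<Sum>l\<in>K. card {x. u x + l * v x = 0}) = (\<Sum>l\<in>K. \<Sum>x\<in>UNIV. if u x + l * v x = 0 then 1 else 0)"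
    by (simp add: sum.If_cases)
  also have "\<dots> = (\<Sum>x\<in>UNIV. card {l \<in> K. u x + l * v x = 0})"
    by (subst sum.swap) (simp add: sum.If_cases Int_def)
  also have "\<dots> = (\<Sum>x\<in>UNIV. (if v x \<noteq> 0 then 1 else 0) + (if u x = 0 \<and> v x = 0 then p else 0))"
    by (rule sum.cong) (auto simp: cnt)
  also have "\<dots> = wt UNIV v + p * ?m"
    by (simp add: sum.distrib sum.If_cases wt_def)
  finally have "wt UNIV v + p * ?m = (\<Sum>l\<in>K. card {x. u x + l * v x = 0})" by simp
  also have "\<dots> \<le> (\<Sum>l\<in>K. p + 1)"
  proof (rule sum_mono)
    fix l assume l: "l \<in> K"
    have "(\<lambda>x. u x + l * v x) \<in> C"
      using linear_codeD(3)[OF linear_code_C u linear_codeD(4)[OF linear_code_C l v(1)]] .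
    then show "card {x. u x + l * v x = 0} \<le> p + 1" by (rule zeros_le[OF _ indep[OF l]])
  qed
  also have "\<dots> = p * (p + 1)" by (simp add: card_K)
  \<comment> \<open>The weight bound for \<open>v\<close> leaves \<open>p * ?m\<close> at most
    \<open>2 * p + 1\<close>, which is less than \<open>3 * p\<close>.\<close>
  finally have "(p ^ 2 - p - 1) + p * ?m \<le> p * (p + 1)" using wt_C_ge[OF v] by linarith
  then have "p * ?m \<le> 2 * p + 1" using p_plus_1_less by (simp add: power2_eq_square)
  then have "p * ?m < p * 3" using p_ge_3 by linarith
  then show ?thesis by simp
qed

section \<open>Dual words of small weight\<close>

text \<open>Independent words share at most two zeros, so all words vanishing on \<open>S\<close>
  are multiples of a single one.\<close>

lemma card_vanishing_le:
  assumes "card S \<ge> 3"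
  shows "card {c \<in> C. \<forall>x\<in>S. c x = 0} \<le> p"
proof (cases "{c \<in> C. \<forall>x\<in>S. c x = 0} \<subseteq> {\<lambda>x. 0}")
  case True
  then have "card {c \<in> C. \<forall>x\<in>S. c x = 0} \<le> card {\<lambda>x :: 'a. 0 :: 'a}"
    by (intro card_mono) auto
  then show ?thesis using p_gt_1 by simp
next
  case False
  then obtain v where v: "v \<in> C" "v \<noteq> (\<lambda>x. 0)" "\<forall>x\<in>S. v x = 0" by blast
  have "{c \<in> C. \<forall>x\<in>S. c x = 0} \<subseteq> (\<lambda>l x. - l * v x) ` K"
  proof
    fix u assume u: "u \<in> {c \<in> C. \<forall>x\<in>S. c x = 0}"
    have "\<exists>l\<in>K. (\<lambda>x. u x + l * v x) = (\<lambda>x. 0)"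
    proof (rule ccontr)
      assume "\<not> (\<exists>l\<in>K. (\<lambda>x. u x + l * v x) = (\<lambda>x. 0))"
      then have neg: "\<forall>l\<in>K. (\<lambda>x. u x + l * v x) \<noteq> (\<lambda>x. 0)" by (simp only: bex_simps not_False_eq_True)
      have "u \<in> C" using u by simp
      then have "card {x. u x = 0 \<and> v x = 0} \<le> 2"
      proof (rule common_zeros_le[OF _ v(1,2)])
        show "(\<lambda>x. u x + l * v x) \<noteq> (\<lambda>x. 0)" if "l \<in> K" for l by (rule bspec[OF neg that])
      qed
      moreover have "card S \<le> card {x. u x = 0 \<and> v x = 0}"
        by (rule card_mono) (use u v(3) in auto)
      ultimately show False using assms by simp
    qed
    then obtain l where l: "l \<in> K" "(\<lambda>x. u x + l * v x) = (\<lambda>x. 0)" by (rule bexE)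
    then have "u x + l * v x = 0" for x by (metis (mono_tags))
    then have "u = (\<lambda>x. - l * v x)" by (auto simp: eq_neg_iff_add_eq_0)
    then show "u \<in> (\<lambda>l x. - l * v x) ` K" using l(1) by blast
  qed
  then have "card {c \<in> C. \<forall>x\<in>S. c x = 0} \<le> card ((\<lambda>l x. - l * v x) ` K)"
    by (intro card_mono) auto
  also have "\<dots> \<le> p" using card_image_le[of K "\<lambda>l x. - l * v x"] by (simp add: card_K)
  finally show ?thesis .
qed

text \<open>At most \<open>p\<close> of the \<open>p ^ 4\<close> codewords vanish on
  \<open>S\<close>, so the restriction to \<open>S\<close> has at least \<open>p ^ 3\<close> words.
  It is the full space, and its dual is trivial.\<close>

lemma dual_eq_0_if_support_3:
  assumes "card S = 3" "w \<in> vecs K S" "w \<in> D"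
  shows "w = (\<lambda>x. 0)"
proof -
  let ?E = "restr S ` C"
  note E = linear_code_restr[OF linear_code_C subset_UNIV, of S]
  have "p ^ 4 = card ?E * card {c \<in> C. \<forall>x\<in>S. c x = 0}"
    using card_restr[OF finite linear_code_C] card_C by metis
  also have "\<dots> \<le> card ?E * p" using card_vanishing_le[of S] assms(1) by simp
  finally have "p ^ 3 * p \<le> card ?E * p" by (simp add: power_Suc2[symmetric] del: power_Suc)
  then have "p ^ 3 \<le> card ?E" using p_gt_0 by simp
  moreover have "card ?E * card (dual_code K S ?E) = p ^ 3"
    using card_mult_card_dual[OF finite E] assms(1) by simp
  ultimately have "card ?E * card (dual_code K S ?E) \<le> card ?E * 1" by simp
  then have "card (dual_code K S ?E) \<le> 1"
    using linear_code_card_pos[OF finite E] by (simp only: mult_le_cancel1)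
  moreover have "w \<in> dual_code K S ?E"
    unfolding dual_restr_iff[OF finite subset_UNIV] using assms(2,3) by (rule conjI)
  moreover have "(\<lambda>x. 0) \<in> dual_code K S ?E"
    using linear_codeD(2)[OF linear_code_dual] .
  moreover have "finite (dual_code K S ?E)"
    using linear_code_finite[OF finite linear_code_dual] .
  ultimately show ?thesis by (auto simp: card_le_Suc0_iff_eq)
qed

lemma wt_dual_ge:
  assumes "w \<in> D" "w \<noteq> (\<lambda>x. 0)"
  shows "wt UNIV w \<ge> 4"
proof (rule ccontr)
  assume "\<not> wt UNIV w \<ge> 4"
  then have le: "card {x. w x \<noteq> 0} \<le> 3" by (simp add: wt_def)
  have "3 \<le> card (UNIV :: 'a set)" using p_plus_1_less p_ge_3 by (simp add: card_field)
  then obtain S where S: "{x. w x \<noteq> 0} \<subseteq> S" "card S = 3"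
    using exists_subset_between[OF le, of UNIV] by auto
  have "w \<in> vecs K S"
    using S(1) assms(1) by (auto simp: dual_code_def vecs_altdef)
  then show False using dual_eq_0_if_support_3[OF S(2) _ assms(1)] assms(2) by simp
qed

text \<open>Four zeros of a nonzero word \<open>u\<close>, one of them \<open>x0\<close>, are
  available because \<open>p + 1\<close> is at least 4. Restriction to them kills \<open>u\<close>,
  so its image is not the full space and has a nonzero dual word; the dual distance forces that word
  to be nonzero on all four points.\<close>

lemma dual_word_wt_4:
  obtains w where "w \<in> D" "w x0 \<noteq> 0" "wt UNIV w = 4"
proof -
  obtain u where u: "u \<in> C" "u x0 = 0" "card {x. u x = 0} = p + 1" by (rule max_zeros_through)
  obtain S where S: "{x0} \<subseteq> S" "S \<subseteq> {x. u x = 0}" "card S = 4"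
    using exists_subset_between[of "{x0}" 4 "{x. u x = 0}"] u p_ge_3 by auto
  let ?E = "restr S ` C"
  note E = linear_code_restr[OF linear_code_C subset_UNIV, of S]
  have "u \<noteq> (\<lambda>x. 0)" using u(3) p_plus_1_less by (auto simp: card_field)
  have "card {u, \<lambda>x. 0} \<le> card {c \<in> C. \<forall>x\<in>S. c x = 0}"
    by (rule card_mono) (use u S linear_codeD(2)[OF linear_code_C] in auto)
  then have "2 \<le> card {c \<in> C. \<forall>x\<in>S. c x = 0}" using \<open>u \<noteq> (\<lambda>x. 0)\<close> by simp
  then have "card ?E * 2 \<le> card ?E * card {c \<in> C. \<forall>x\<in>S. c x = 0}" by (rule mult_le_mono2)
  also have "\<dots> = p ^ 4" using card_restr[OF finite linear_code_C] card_C by metis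
  also have "\<dots> = card ?E * card (dual_code K S ?E)"
    using card_mult_card_dual[OF finite E] S(3) by simp
  finally have "2 \<le> card (dual_code K S ?E)"
    using linear_code_card_pos[OF finite E] by simp
  then have "\<not> dual_code K S ?E \<subseteq> {\<lambda>x. 0}"
    using card_mono[of "{\<lambda>x. 0}" "dual_code K S ?E"] by auto
  then obtain w where w: "w \<in> dual_code K S ?E" "w \<noteq> (\<lambda>x. 0)" by (auto simp only: subset_iff singleton_iff)
  have wD: "w \<in> D" and wS: "w \<in> vecs K S"
    using w(1)[unfolded dual_restr_iff[OF finite subset_UNIV]] by (rule conjunct2, rule conjunct1)
  have sub: "{x \<in> UNIV. w x \<noteq> 0} \<subseteq> S" using wS by (auto simp: vecs_altdef)
  have "card {x \<in> UNIV. w x \<noteq> 0} = card S"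
    using wt_dual_ge[OF wD w(2)] card_mono[OF finite sub] S(3) by (simp add: wt_def)
  then have "{x \<in> UNIV. w x \<noteq> 0} = S" using sub by (intro card_subset_eq) auto
  then show thesis using that[OF wD] S by (auto simp: wt_def)
qed

section \<open>Optimal dimensions for the two shortened lengths\<close>

text \<open>These are the parameters of the Cadambe-Mazumdar term for \<open>C\<close> at
  \<open>t = 1\<close>. The repetition code has weight \<open>p ^ 2 - 4\<close>, enough since
  \<open>p\<close> is at least 3, and Plotkin excludes dimension 2.\<close>

lemma kopt_repetition: "kopt K (p ^ 2 - 4) (p ^ 2 - p - 1) = 1"
proof -
  define n where "n = p ^ 2 - 4"
  have pp: "3 * p \<le> p ^ 2" using p_ge_3 by (simp add: power2_eq_square)
  define R where "R = (\<lambda>a i. if i < n then a else 0) ` K"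
  have R: "linear_code K {..<n} R"
    unfolding linear_code_def
  proof (intro conjI ballI)
    show "R \<subseteq> vecs K {..<n}" by (auto simp: R_def vecs_def)
    show "(\<lambda>i. 0) \<in> R" unfolding R_def by (rule image_eqI[of _ _ 0]) auto
  next
    fix c d assume "c \<in> R" "d \<in> R"
    then obtain a b where "a \<in> K" "b \<in> K" "c = (\<lambda>i. if i < n then a else 0)" "d = (\<lambda>i. if i < n then b else 0)"
      unfolding R_def by blast
    then show "(\<lambda>i. c i + d i) \<in> R" unfolding R_def by (intro image_eqI[of _ _ "a + b"]) auto
  next
    fix a c assume "a \<in> K" "c \<in> R"
    then obtain b where "b \<in> K" "c = (\<lambda>i. if i < n then b else 0)" unfolding R_def by blast
    then show "(\<lambda>i. a * c i) \<in> R" unfolding R_def using \<open>a \<in> K\<close> by (intro image_eqI[of _ _ "a * b"]) auto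
  qed
  have "n > 0" using pp p_ge_3 by (simp add: n_def)
  then have "inj_on (\<lambda>a i. if i < n then a else (0 :: 'a)) K"
    by (intro inj_onI) (metis (full_types))
  then have "card R = p ^ 1" unfolding R_def by (simp add: card_image card_K)
  then have "code_dim K R = 1" by (rule code_dim_eqI)
  show ?thesis
    unfolding n_def[symmetric]
  proof (rule kopt_eqI[OF R])
    fix c assume "c \<in> R" "c \<noteq> (\<lambda>i. 0)"
    then obtain a where a: "c = (\<lambda>i. if i < n then a else 0)" unfolding R_def by blast
    then have "a \<noteq> 0" using \<open>c \<noteq> (\<lambda>i. 0)\<close> by auto
    with a have "{i \<in> {..<n}. c i \<noteq> 0} = {..<n}" by auto
    then show "p ^ 2 - p - 1 \<le> wt {..<n} c" using p_ge_3 by (simp add: wt_def n_def)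
  next
    show "1 \<le> code_dim K R" using \<open>code_dim K R = 1\<close> by simp
  next
    fix B :: "(nat \<Rightarrow> 'a) set"
    assume B: "linear_code K {..<n} B" "\<And>c. c \<in> B \<Longrightarrow> c \<noteq> (\<lambda>i. 0) \<Longrightarrow> p ^ 2 - p - 1 \<le> wt {..<n} c"
    show "code_dim K B \<le> 1"
    proof (rule ccontr)
      assume "\<not> code_dim K B \<le> 1"
      then have "p ^ 2 \<le> p ^ code_dim K B" using p_gt_0 by (intro power_increasing) auto
      then have big: "p ^ 2 \<le> card B" using card_eq_power_code_dim(1)[OF _ B(1)] by simp
      have "p * ((p ^ 2 - p - 1) * (card B - 1)) \<le> n * ((p - 1) * card B)"
        using plotkin_bound[OF _ B] by simp
      then have "int (p * ((p ^ 2 - p - 1) * (card B - 1))) \<le> int (n * ((p - 1) * card B))"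
        by (simp only: of_nat_le_iff)
      \<comment> \<open>The comparison is done over the integers, where no subtraction is
        truncated.\<close>
      moreover have "int (p ^ 2 - p - 1) = int p ^ 2 - int p - 1" "int (card B - 1) = int (card B) - 1"
        "int n = int p ^ 2 - 4" "int (p - 1) = int p - 1"
        using pp p_ge_3 big by (auto simp: n_def of_nat_diff)
      ultimately have ineq: "int p * ((int p ^ 2 - int p - 1) * (int (card B) - 1))
          \<le> (int p ^ 2 - 4) * ((int p - 1) * int (card B))" by simp
      define P M where "P = int p" and "M = int (card B)"
      have PM: "P \<ge> 3" "P ^ 2 \<le> M"
        using p_ge_3 big unfolding P_def M_def by (simp_all flip: of_nat_power)
      \<comment> \<open>The leading terms cancel. As \<open>M\<close> is at least
        \<open>P ^ 2\<close> and \<open>3 * P - 4\<close> exceeds \<open>P\<close>, the left side is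
        too large.\<close>
      have "(3 * P - 4) * M \<le> P * (P ^ 2 - P - 1)"
        using ineq unfolding P_def[symmetric] M_def[symmetric]
        by (simp add: algebra_simps power2_eq_square power3_eq_cube)
      moreover have "(3 * P - 4) * P ^ 2 \<le> (3 * P - 4) * M" using PM by (intro mult_left_mono) auto
      moreover have "P * (P ^ 2 - P - 1) \<le> P * P ^ 2" using PM by (intro mult_left_mono) auto
      moreover have "P ^ 2 * P < P ^ 2 * (3 * P - 4)" using PM by (intro mult_strict_left_mono) auto
      ultimately show False by (simp add: mult.commute)
    qed
  qed
qed

text \<open>The term for \<open>D\<close> at \<open>t = 1\<close>. On the zero set \<open>Z\<close>
  of a word \<open>u\<close>, the restriction of \<open>C\<close> loses \<open>u\<close> and has
  dimension at most 3. Its dual, a shortening of \<open>D\<close>, keeps distance 4 and has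
  dimension at least \<open>p - 2\<close>, the Singleton limit.\<close>

lemma kopt_MDS: "kopt K (p + 1) 4 = p - 2"
proof -
  obtain u where u: "u \<in> C" "u 0 = 0" "card {x. u x = 0} = p + 1" by (rule max_zeros_through)
  define Z where "Z = {x. u x = 0}"
  let ?E = "restr Z ` C"
  note E = linear_code_restr[OF linear_code_C subset_UNIV, of Z]
  have "u \<noteq> (\<lambda>x. 0)" using u(3) p_plus_1_less by (auto simp: card_field)
  have "card {u, \<lambda>x. 0} \<le> card {c \<in> C. \<forall>x\<in>Z. c x = 0}"
    by (rule card_mono) (use u linear_codeD(2)[OF linear_code_C] in \<open>auto simp: Z_def\<close>)
  then have "2 \<le> card {c \<in> C. \<forall>x\<in>Z. c x = 0}" using \<open>u \<noteq> (\<lambda>x. 0)\<close> by simp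
  then have "card ?E * 2 \<le> card ?E * card {c \<in> C. \<forall>x\<in>Z. c x = 0}" by (rule mult_le_mono2)
  also have "\<dots> = p ^ 4" using card_restr[OF finite linear_code_C] card_C by metis
  finally have "card ?E < p ^ 4" using linear_code_card_pos[OF finite E] by linarith
  then have dimE: "code_dim K ?E \<le> 3"
    using card_eq_power_code_dim(1)[OF finite E] p_gt_1 by simp
  let ?F = "dual_code K Z ?E"
  have "wt Z c \<ge> 4" if c: "c \<in> ?F" "c \<noteq> (\<lambda>x. 0)" for c
  proof -
    have "c \<in> D" "c \<in> vecs K Z"
      using c(1)[unfolded dual_restr_iff[OF finite subset_UNIV]] by (rule conjunct2, rule conjunct1)
    then have "{x \<in> UNIV. c x \<noteq> 0} = {x \<in> Z. c x \<noteq> 0}" by (auto simp: vecs_altdef)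
    then show ?thesis using wt_dual_ge[OF \<open>c \<in> D\<close> c(2)] by (simp add: wt_def)
  qed
  then obtain F where F: "linear_code K {..<p + 1} F" "card F = card ?F"
    "\<And>c. c \<in> F \<Longrightarrow> c \<noteq> (\<lambda>i. 0) \<Longrightarrow> wt {..<p + 1} c \<ge> 4"
    using reindex_code[OF finite linear_code_dual, of Z "p + 1" ?E 4] u(3) unfolding Z_def[symmetric] by metis
  have "p ^ code_dim K ?E * p ^ code_dim K F = p ^ (p + 1)"
    using card_mult_card_dual[OF finite E] card_eq_power_code_dim(1)[OF finite E]
      card_eq_power_code_dim(1)[OF finite_lessThan F(1)] F(2) u(3) by (simp add: Z_def)
  then have "code_dim K ?E + code_dim K F = p + 1"
    using p_gt_1 by (simp flip: power_add del: power_Suc)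
  then have dimF: "p - 2 \<le> code_dim K F" using dimE by simp
  show ?thesis
  proof (rule kopt_eqI[OF F(1) F(3) dimF])
    fix B :: "(nat \<Rightarrow> 'a) set"
    assume "linear_code K {..<p + 1} B" "\<And>c. c \<in> B \<Longrightarrow> c \<noteq> (\<lambda>i. 0) \<Longrightarrow> 4 \<le> wt {..<p + 1} c"
    then show "code_dim K B \<le> p - 2"
      using singleton_bound[of "{..<p + 1}" B 4] p_ge_3 by simp
  qed auto
qed

section \<open>Parameters and optimality of both codes\<close>

lemma dim_C: "code_dim K C = 4"
  by (rule code_dim_eqI) (fact card_C)

lemma min_dist_C: "min_dist UNIV C = p ^ 2 - p - 1"
proof -
  obtain u where u: "u \<in> C" "u 0 \<noteq> 0" "card {x. u x = 0} = p + 1" by (rule max_zeros_avoiding)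
  show ?thesis
    by (rule min_dist_eqI[where ?c0.0 = u, OF finite linear_code_C wt_C_ge]) (use u in \<open>auto simp: wt_eq\<close>)
qed

lemma locality_C: "locality UNIV C = 3"
proof (rule locality_eqI[OF finite linear_code_C])
  show "\<exists>w\<in>D. w x \<noteq> 0 \<and> wt UNIV w = Suc 3" for x
  proof -
    obtain w where "w \<in> D" "w x \<noteq> 0" "wt UNIV w = 4" by (rule dual_word_wt_4)
    then show ?thesis by (intro bexI[of _ w]) auto
  qed
  show "Suc 3 \<le> wt UNIV w" if "w \<in> D" "w \<noteq> (\<lambda>x. 0)" for w
    using wt_dual_ge[OF that] by simp
qed simp

lemma p2_ge: "3 * p \<le> p ^ 2"
  using p_ge_3 by (simp add: power2_eq_square)

lemma dim_D: "code_dim K D = p ^ 2 - 4"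
proof (rule code_dim_eqI)
  have "p ^ 2 = 4 + (p ^ 2 - 4)" using p2_ge p_ge_3 by simp
  then have "p ^ 4 * card D = p ^ 4 * p ^ (p ^ 2 - 4)"
    using card_mult_card_dual[OF finite linear_code_C] by (metis card_C card_field power_add)
  then show "card D = p ^ (p ^ 2 - 4)" using p_gt_0 by simp
qed

lemma min_dist_D: "min_dist UNIV D = 4"
proof -
  obtain w where w: "w \<in> D" "w 0 \<noteq> 0" "wt UNIV w = 4" by (rule dual_word_wt_4)
  show ?thesis
    by (rule min_dist_eqI[where ?c0.0 = w, OF finite linear_code_dual wt_dual_ge]) (use w in auto)
qed

text \<open>By biduality the parity checks of \<open>D\<close> are the words of \<open>C\<close>,
  whose words of minimum weight cover every coordinate.\<close>

lemma locality_D: "locality UNIV D = p ^ 2 - p - 2"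
proof (rule locality_eqI[OF finite linear_code_dual])
  have eq: "Suc (p ^ 2 - p - 2) = p ^ 2 - p - 1" using p2_ge p_ge_3 by simp
  have DD: "dual_code K UNIV D = C" by (rule bidual[OF finite linear_code_C])
  show "\<exists>u\<in>dual_code K UNIV D. u x \<noteq> 0 \<and> wt UNIV u = Suc (p ^ 2 - p - 2)" for x
  proof -
    obtain u where "u \<in> C" "u x \<noteq> 0" "card {x. u x = 0} = p + 1" by (rule max_zeros_avoiding)
    then show ?thesis unfolding DD eq by (intro bexI[of _ u]) (auto simp: wt_eq)
  qed
  show "Suc (p ^ 2 - p - 2) \<le> wt UNIV u" if "u \<in> dual_code K UNIV D" "u \<noteq> (\<lambda>x. 0)" for u
    using that unfolding DD eq by (rule wt_C_ge)
qed simp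

lemma k_optimal_C: "k_optimal K UNIV C"
proof -
  let ?g = "\<lambda>t. 3 * t + kopt K (p ^ 2 - t * (3 + 1)) (p ^ 2 - p - 1)"
  have "(INF t\<in>{1..}. ?g t) = 4"
  proof (rule cInf_eq_minimum)
    have "?g 1 = 4" using kopt_repetition by simp
    then show "4 \<in> ?g ` {1..}" by (intro rev_image_eqI[of 1]) simp_all
    fix y assume "y \<in> ?g ` {1..}"
    then obtain t where "t \<ge> 1" "y = ?g t" by auto
    \<comment> \<open>From \<open>t = 2\<close> on, the summand \<open>3 * t\<close> alone exceeds
      4, whatever the remaining, possibly truncated, length.\<close>
    then show "4 \<le> y" using \<open>?g 1 = 4\<close> by (cases "t = 1") auto
  qed
  then show ?thesis
    unfolding k_optimal_def Let_def dim_C min_dist_C locality_C card_field by simp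
qed

lemma k_optimal_D: "k_optimal K UNIV D"
proof -
  let ?r = "p ^ 2 - p - 2"
  let ?g = "\<lambda>t. ?r * t + kopt K (p ^ 2 - t * (?r + 1)) 4"
  have "(INF t\<in>{1..}. ?g t) = p ^ 2 - 4"
  proof (rule cInf_eq_minimum)
    have "p ^ 2 - 1 * (?r + 1) = p + 1" using p2_ge p_ge_3 by simp
    then have 1: "?g 1 = p ^ 2 - 4" using kopt_MDS p2_ge p_ge_3 by simp
    then show "p ^ 2 - 4 \<in> ?g ` {1..}" by (intro rev_image_eqI[of 1]) simp_all
    fix y assume "y \<in> ?g ` {1..}"
    then obtain t where t: "t \<ge> 1" "y = ?g t" by auto
    show "p ^ 2 - 4 \<le> y"
    proof (cases "t = 1")
      case False
      then have "?r * 2 \<le> ?r * t" using t(1) by (intro mult_le_mono2) simp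
      \<comment> \<open>From \<open>t = 2\<close> on, the linear summand suffices: twice
        \<open>?r\<close> exceeds \<open>p ^ 2 - 4\<close> by \<open>p ^ 2 - 2 * p\<close>.\<close>
      moreover have "p ^ 2 - 4 \<le> ?r * 2" using p2_ge p_ge_3 by simp
      ultimately show ?thesis using t(2) by linarith
    qed (use 1 t in simp)
  qed
  then show ?thesis
    unfolding k_optimal_def Let_def dim_D min_dist_D locality_D card_field by simp
qed

lemma d_optimal_D: "d_optimal K UNIV D"
proof -
  \<comment> \<open>Since p^2 - 4 = (p - 2)(p + 2) and p^2 - p - 2 = (p - 2)(p + 1), the quotient is
    (p + 2)/(p + 1), strictly between 1 and 2.\<close>
  have "\<lceil>real (p ^ 2 - 4) / real (p ^ 2 - p - 2)\<rceil> = 2"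
  proof -
    have "p ^ 2 - p - 2 > 0" "p ^ 2 - p - 2 < p ^ 2 - 4" "p ^ 2 - 4 \<le> 2 * (p ^ 2 - p - 2)"
      using p2_ge p_ge_3 by auto
    then have "real (p ^ 2 - p - 2) > 0" "real (p ^ 2 - p - 2) < real (p ^ 2 - 4)"
      "real (p ^ 2 - 4) \<le> 2 * real (p ^ 2 - p - 2)"
      by linarith+
    then show ?thesis by (simp add: ceiling_eq_iff field_simps del: of_nat_diff)
  qed
  moreover have "int (p ^ 2 - 4) = int (p ^ 2) - 4" using p2_ge p_ge_3 by (simp add: of_nat_diff)
  ultimately show ?thesis
    unfolding d_optimal_def Let_def dim_D min_dist_D locality_D card_field by linarith
qed

end

theorem theorem4p9:
  fixes p :: nat and f :: "'a::{field,finite} \<Rightarrow> 'a" and \<epsilon> :: int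
  assumes "prime p" and "odd p"
    and "card (UNIV :: 'a set) = p ^ 2"
    and "in_RF p 2 f"
    and "weakly_regular_bent p 2 f \<epsilon>"
    and "\<epsilon> * eta0 p (-1 :: 'a) = -1"
  shows "is_LRC (Fp p) UNIV (code_Cf p f) (p^2) 4 (p^2 - p - 1) 3
       \<and> is_LRC (Fp p) UNIV (dual_code (Fp p) UNIV (code_Cf p f)) (p^2) (p^2 - 4) 4 (p^2 - p - 2)
       \<and> k_optimal (Fp p) UNIV (code_Cf p f)
       \<and> k_optimal (Fp p) UNIV (dual_code (Fp p) UNIV (code_Cf p f))
       \<and> d_optimal (Fp p) UNIV (dual_code (Fp p) UNIV (code_Cf p f))"
proof -
  interpret quadratic_extension p "Fp p :: 'a set"
    by unfold_locales (use assms CHAR_eq_prime in auto)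
  interpret elliptic_function p "Fp p :: 'a set" f
  proof
    show "f x \<in> Fp p" for x using assms(5) by (simp add: weakly_regular_bent_def)
    show "\<exists>s\<in>Fp p. \<forall>t\<in>Fp p. card {x. f x - tr p 2 (b * x) = t} = (if t = s then 1 else p + 1)" for b
      using weakly_regular_bent_fibres[OF assms(5,6), of b] by metis
  qed
  show ?thesis
    unfolding is_LRC_def
    using linear_code_C linear_code_dual card_field dim_C dim_D min_dist_C min_dist_D locality_C
      locality_D k_optimal_C k_optimal_D d_optimal_D
    by auto
qed

end
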